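(* Let $\Delta$ be the triangle graph with bond dimensions $\mathbf m=(2,2,2)$ and local dimensions $\mathbf n=(3,3,3)$, let $V_0,V_1,V_2$ be complex vector spaces of dimension $3$, and let $T\in V_0\otimes V_1\otimes V_2$. The following are equivalent: (1) $T\in\mathcal{TNS}^\Delta_{\mathbf m,\mathbf n}$; (2) the defining polynomials of $\mathscr E_0(T),\mathscr E_1(T),\mathscr E_2(T)$ are (all three) reducible; (3) $T$ is in the orbit-closure of the family of tensors $T^{(\lambda)}_{\mathrm{II.2}}$, that is, $T\in\overline{(GL(V_0)\times GL(V_1)\times GL(V_2))\cdot\{T^{(\lambda)}_{\mathrm{II.2}}:\lambda\in\mathbb C\}}$.
   Context: Everything is over $\mathbb C$; the overline denotes Zariski (equivalently Euclidean) closure. Tensor network variety: with $W_0=W_1=W_2=\mathbb C^2\otimes\mathbb C^2$ having bases $v^{(0)}_{ij},v^{(1)}_{ij},v^{(2)}_{ij}$ ($i,j\in\{0,1\}$), the graph tensor is $T(\Delta,(2,2,2))=\sum_{i,j,k=0}^1v^{(0)}_{ij}\otimes v^{(1)}_{jk}\otimes v^{(2)}_{ki}$, and $\mathcal{TNS}^\Delta_{(2,2,2),(3,3,3)}\subseteq V_0\otimes V_1\otimes V_2$ is the closure of the set of all $(X_0\otimes X_1\otimes X_2)(T(\Delta,(2,2,2)))$ with $X_i\in\mathrm{Hom}(W_i,V_i)$. Determinantal cubics: for $i\in\{0,1,2\}$, $T$ defines by contraction a linear map $T:V_i^*\to V_j\otimes V_k$ ($\{i,j,k\}=\{0,1,2\}$),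 and, identifying $V_j\otimes V_k$ with $3\times3$ matrices, $\mathscr E_i(T)=\{\alpha\in\mathbb PV_i^*:\det(T(\alpha))=0\}$. Its defining polynomial is the cubic form $\alpha\mapsto\det(T(\alpha))$, an element of $S^3V_i$ well defined up to scale. The zero polynomial is counted as reducible (a cubic form is "reducible" if it is a product of a linear form and a quadratic form, possibly zero). The family: with bases $a_0,a_1,a_2$ of $V_0$, $b_0,b_1,b_2$ of $V_1$, $c_0,c_1,c_2$ of $V_2$, $$T^{(\lambda)}_{\mathrm{II.2}}=a_0\otimes b_0\otimes c_0+a_1\otimes b_1\otimes c_1+a_2\otimes b_2\otimes c_2+\lambda(a_0\otimes b_1\otimes c_2+a_1\otimes b_2\otimes c_0+a_2\otimes b_0\otimes c_1)+a_0\otimes b_2\otimes c_1.$$ *)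

theory Defs
  imports "HOL-Analysis.Analysis"
begin

text \<open>
  After a choice of bases, a complex vector space is \<open>complex^'p\<close> for a finite index type \<open>'p\<close>,
  its dual is \<open>complex^'p\<close> in the dual basis, the tensor product of three such spaces is the space
  of arrays indexed by \<open>'p \<times> 'q \<times> 'r\<close>, and linear maps are matrices.  The numeral types
  \<open>2\<close> and \<open>3\<close> have the elements \<open>0, 1\<close> and \<open>0, 1, 2\<close>.
\<close>

type_synonym ('p, 'q, 'r) tensor3 = "complex ^ ('p \<times> 'q \<times> 'r)"

definition tensor :: "complex^'p \<Rightarrow> complex^'q \<Rightarrow> complex^'r \<Rightarrow> ('p::finite, 'q::finite, 'r::finite) tensor3"
  where "tensor u v w = vec_lambda (\<lambda>(i, j, k). u $ i * v $ j * w $ k)"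

text \<open>The linear map \<open>X0 \<otimes> X1 \<otimes> X2\<close>, which sends \<open>tensor u v w\<close> to
  \<open>tensor (X0 *v u) (X1 *v v) (X2 *v w)\<close>.\<close>

definition tensor_map ::
  "complex^'p^'a \<Rightarrow> complex^'q^'b \<Rightarrow> complex^'r^'c
    \<Rightarrow> ('p::finite, 'q::finite, 'r::finite) tensor3 \<Rightarrow> ('a::finite, 'b::finite, 'c::finite) tensor3"
  where "tensor_map X0 X1 X2 T =
    vec_lambda (\<lambda>(i, j, k). \<Sum>p\<in>UNIV. \<Sum>q\<in>UNIV. \<Sum>r\<in>UNIV.
        X0 $ i $ p * X1 $ j $ q * X2 $ k $ r * T $ (p, q, r))"

lemma tensor_map_tensor:
  "tensor_map X0 X1 X2 (tensor u v w) = tensor (X0 *v u) (X1 *v v) (X2 *v w)"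
  by (simp add: tensor_map_def tensor_def matrix_vector_mult_def vec_eq_iff sum_product
      sum_distrib_left sum_distrib_right mult_ac, intro allI, rule sum.swap)

text \<open>The basis vector \<open>v\<^sub>i\<^sub>j\<close> of \<open>W = C\<^sup>2 \<otimes> C\<^sup>2\<close> is \<open>axis (i, j) 1\<close>.\<close>

definition triangle_tensor :: "(2 \<times> 2, 2 \<times> 2, 2 \<times> 2) tensor3"
  where "triangle_tensor =
    (\<Sum>i\<in>UNIV. \<Sum>j\<in>UNIV. \<Sum>k\<in>UNIV. tensor (axis (i, j) 1) (axis (j, k) 1) (axis (k, i) 1))"

text \<open>The closure is the Euclidean one; for these sets it coincides with the Zariski closure.\<close>

definition TNS_triangle :: "(3, 3, 3) tensor3 set"
  where "TNS_triangle =
    closure {tensor_map X0 X1 X2 triangle_tensor | X0 X1 X2. True}"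

definition contract0 :: "(3, 3, 3) tensor3 \<Rightarrow> complex^3 \<Rightarrow> complex^3^3"
  where "contract0 T \<alpha> = (\<chi> j k. \<Sum>i\<in>UNIV. \<alpha> $ i * T $ (i, j, k))"

definition contract1 :: "(3, 3, 3) tensor3 \<Rightarrow> complex^3 \<Rightarrow> complex^3^3"
  where "contract1 T \<alpha> = (\<chi> i k. \<Sum>j\<in>UNIV. \<alpha> $ j * T $ (i, j, k))"

definition contract2 :: "(3, 3, 3) tensor3 \<Rightarrow> complex^3 \<Rightarrow> complex^3^3"
  where "contract2 T \<alpha> = (\<chi> i j. \<Sum>k\<in>UNIV. \<alpha> $ k * T $ (i, j, k))"

text \<open>Forms on the dual spaces are represented by their polynomial functions, which determine
  the polynomials because the complex field is infinite.\<close>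

definition linear_form :: "(complex^3 \<Rightarrow> complex) \<Rightarrow> bool"
  where "linear_form l \<longleftrightarrow> (\<exists>u::complex^3. \<forall>\<alpha>. l \<alpha> = (\<Sum>i\<in>UNIV. u $ i * \<alpha> $ i))"

definition quadratic_form :: "(complex^3 \<Rightarrow> complex) \<Rightarrow> bool"
  where "quadratic_form q \<longleftrightarrow>
    (\<exists>A::complex^3^3. \<forall>\<alpha>. q \<alpha> = (\<Sum>i\<in>UNIV. \<Sum>j\<in>UNIV. A $ i $ j * \<alpha> $ i * \<alpha> $ j))"

text \<open>The factors may vanish, so the zero cubic is reducible.\<close>

definition reducible_cubic :: "(complex^3 \<Rightarrow> complex) \<Rightarrow> bool"
  where "reducible_cubic f \<longleftrightarrow>
    (\<exists>l q. linear_form l \<and> quadratic_form q \<and> (\<forall>\<alpha>. f \<alpha> = l \<alpha> * q \<alpha>))"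

definition det_cubic0 :: "(3, 3, 3) tensor3 \<Rightarrow> complex^3 \<Rightarrow> complex"
  where "det_cubic0 T \<alpha> = det (contract0 T \<alpha>)"

definition det_cubic1 :: "(3, 3, 3) tensor3 \<Rightarrow> complex^3 \<Rightarrow> complex"
  where "det_cubic1 T \<alpha> = det (contract1 T \<alpha>)"

definition det_cubic2 :: "(3, 3, 3) tensor3 \<Rightarrow> complex^3 \<Rightarrow> complex"
  where "det_cubic2 T \<alpha> = det (contract2 T \<alpha>)"

definition basis_tensor :: "3 \<Rightarrow> 3 \<Rightarrow> 3 \<Rightarrow> (3, 3, 3) tensor3"
  where "basis_tensor i j k = tensor (axis i 1) (axis j 1) (axis k 1)"

definition T_II2 :: "complex \<Rightarrow> (3, 3, 3) tensor3"
  where "T_II2 lam =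
    basis_tensor 0 0 0 + basis_tensor 1 1 1 + basis_tensor 2 2 2
    + lam *s (basis_tensor 0 1 2 + basis_tensor 1 2 0 + basis_tensor 2 0 1)
    + basis_tensor 0 2 1"

definition orbit_closure_II2 :: "(3, 3, 3) tensor3 set"
  where "orbit_closure_II2 =
    closure {tensor_map g0 g1 g2 (T_II2 lam) | g0 g1 g2 lam.
      invertible g0 \<and> invertible g1 \<and> invertible g2}"

end

theory Submission
  imports Defs
begin

text \<open>
  Call \<open>T\<close> a tensor with a zero block if the trilinear form of \<open>T\<close> vanishes on a product of three
  planes.  All conditions of the theorem are equivalent to this one, and no classification of
  \<open>3 \<times> 3 \<times> 3\<close> tensors is needed.

  A determinantal cubic is reducible iff it vanishes on a plane, i.e. iff the plane parametrises a
  singular pencil of matrices.  Such a pencil is a compression space, so that \<open>T\<close> has a zero block or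
  a slice of rank at most one in one of the two other directions.  If this holds for all three cubics
  and there is no zero block, then two different directions have such slices, and these produce a zero
  block after all.

  In suitable bases a tensor with a zero block is \<open>t a\<^sub>0b\<^sub>0c\<^sub>0\<close> plus a part linear in the remaining
  vectors plus \<open>a\<^sub>0 \<otimes> M + b\<^sub>0 \<otimes> N + c\<^sub>0 \<otimes> P\<close> for \<open>2 \<times> 2\<close> matrices \<open>M, N, P\<close>.  Generically \<open>M, N, P\<close> can be
  brought simultaneously into antidiagonal form, unipotent substitutions remove the linear part, and a
  torus moves the result into the family \<open>T\<^sub>I\<^sub>I\<^sub>.\<^sub>2\<close>.  Conversely the members of the family with
  \<open>\<lambda>\<^sup>3 \<noteq> -1\<close> are traces \<open>tr (A B C)\<close> with \<open>A, B, C\<close> in spaces spanned by a diagonal matrix and the two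
  off-diagonal matrix units.  Finally, for tensors \<open>tr (A B C)\<close> the cubic is \<open>det A\<close> times a linear form,
  and vanishing on some plane is a closed condition.
\<close>

subsection \<open>Bilinear vector algebra in dimension three\<close>

text \<open>\<open>sum_3\<close>, \<open>forall_3\<close> and \<open>det_3\<close> enumerate the
  type as 1, 2, 3; this identity carries them over to the indices 0, 1, 2.\<close>

lemma three_eq_zero: "(3::3) = 0"
  by simp

lemma distinct_3 [simp]:
  "(0::3) \<noteq> 1" "(0::3) \<noteq> 2" "(1::3) \<noteq> 0" "(1::3) \<noteq> 2" "(2::3) \<noteq> 0" "(2::3) \<noteq> 1"
  by simp_all

lemma sum_3_eq: "sum f (UNIV :: 3 set) = f 0 + f 1 + f 2"
  unfolding sum_3 three_eq_zero by (simp only: ac_simps)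

lemma forall_3_iff: "(\<forall>i::3. P i) \<longleftrightarrow> P 0 \<and> P 1 \<and> P 2"
  unfolding forall_3 three_eq_zero by blast

lemma det_3_eq:
  fixes A :: "'a::comm_ring_1^3^3"
  shows "det A = A$0$0 * (A$1$1 * A$2$2 - A$1$2 * A$2$1)
    - A$0$1 * (A$1$0 * A$2$2 - A$1$2 * A$2$0) + A$0$2 * (A$1$0 * A$2$1 - A$1$1 * A$2$0)"
  unfolding det_3 three_eq_zero by (simp only: algebra_simps)

text \<open>Bilinear rather than Hermitian: it is the pairing with the dual space, so
  \<open>bdot u u\<close> may vanish for nonzero \<open>u\<close>.\<close>

definition bdot :: "complex^3 \<Rightarrow> complex^3 \<Rightarrow> complex"
  where "bdot u v = (\<Sum>i\<in>UNIV. u $ i * v $ i)"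

definition bcross :: "complex^3 \<Rightarrow> complex^3 \<Rightarrow> complex^3"
  where "bcross u v = (\<chi> i. if i = 0 then u$1 * v$2 - u$2 * v$1
    else if i = 1 then u$2 * v$0 - u$0 * v$2 else u$0 * v$1 - u$1 * v$0)"

definition btriple :: "complex^3 \<Rightarrow> complex^3 \<Rightarrow> complex^3 \<Rightarrow> complex"
  where "btriple u v w = bdot u (bcross v w)"

lemma bcross_nth [simp]:
  "bcross u v $ 0 = u$1 * v$2 - u$2 * v$1"
  "bcross u v $ 1 = u$2 * v$0 - u$0 * v$2"
  "bcross u v $ 2 = u$0 * v$1 - u$1 * v$0"
  by (simp_all add: bcross_def)

lemmas coords3 = bdot_def btriple_def sum_3_eq vec_eq_iff forall_3_iff

lemma bdot_axis [simp]: "bdot u (axis i 1) = u $ i" "bdot (axis i 1) u = u $ i"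
proof -
  have "bdot u (axis i 1) = (\<Sum>k\<in>UNIV. if k = i then u $ k else 0)"
    unfolding bdot_def axis_def by (rule sum.cong) auto
  then show "bdot u (axis i 1) = u $ i" by simp
  then show "bdot (axis i 1) u = u $ i" by (simp add: bdot_def mult.commute)
qed

lemma bdot_zero [simp]: "bdot 0 v = 0" "bdot v 0 = 0"
  by (simp_all add: bdot_def)

lemma bdot_linear:
  "bdot u (v + w) = bdot u v + bdot u w" "bdot u (v - w) = bdot u v - bdot u w"
  "bdot u (c *s v) = c * bdot u v"
  "bdot (v + w) u = bdot v u + bdot w u" "bdot (v - w) u = bdot v u - bdot w u"
  "bdot (c *s v) u = c * bdot v u"
  by (simp_all add: coords3 algebra_simps)

lemma bdot_commute: "bdot u v = bdot v u"
  by (simp add: bdot_def mult.commute)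

lemma bdot_bcross_self [simp]:
  "bdot u (bcross u v) = 0" "bdot v (bcross u v) = 0" "bdot (bcross u v) u = 0" "bdot (bcross u v) v = 0"
  by (simp_all add: coords3 algebra_simps)

lemma ex_bdot_neq_0: 
  assumes "u \<noteq> 0" shows "\<exists>a. bdot u a \<noteq> 0"
proof -
  obtain i where "u $ i \<noteq> 0" using assms by (auto simp: vec_eq_iff)
  then have "bdot u (axis i 1) \<noteq> 0" by simp
  then show ?thesis by blast
qed

lemma ex_bdot_eq_1: 
  assumes "u \<noteq> 0" shows "\<exists>a. bdot u a = 1"
proof -
  obtain a where a: "bdot u a \<noteq> 0" using ex_bdot_neq_0[OF assms] by blast
  have "bdot u (inverse (bdot u a) *s a) = 1" using a by (simp add: bdot_linear)
  then show ?thesis by blast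
qed

lemma btriple_rotate: "btriple u v w = btriple v w u" "btriple u v w = btriple w u v"
  by (simp_all add: coords3 algebra_simps)

lemma bcross_bcross: "bcross a (bcross u r) = bdot a r *s u - bdot a u *s r"
  by (simp add: coords3 algebra_simps)

text \<open>Cramer's rule with the denominator cleared, hence valid for dependent triples
  too.\<close>

lemma btriple_cramer:
  "btriple u v w *s z = btriple z v w *s u + btriple u z w *s v + btriple u v z *s w"
  by (simp add: coords3 algebra_simps)

lemma btriple_span:
  assumes "btriple u v w \<noteq> 0"
  shows "z = (btriple z v w / btriple u v w) *s u + (btriple u z w / btriple u v w) *s v
    + (btriple u v z / btriple u v w) *s w"
proof -
  have "z = inverse (btriple u v w) *s (btriple u v w *s z)" using assms by simp
  also have "\<dots> = inverse (btriple u v w) *s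
      (btriple z v w *s u + btriple u z w *s v + btriple u v z *s w)"
    by (simp only: btriple_cramer[of u v w z])
  finally show ?thesis by (simp add: vec.scale_right_distrib divide_inverse mult.commute)
qed

lemma bcross_eq_0D:
  assumes "p \<noteq> 0" "bcross p z = 0"
  shows "\<exists>a. z = a *s p"
proof -
  obtain q where q: "bdot p q = 1" using ex_bdot_eq_1[OF assms(1)] by blast
  have "bcross q (bcross p z) = bdot q z *s p - bdot q p *s z" by (rule bcross_bcross)
  then have "z = bdot q z *s p"
    using q assms(2) by (simp add: bdot_commute[of q p]) (simp add: coords3)
  then show ?thesis by blast
qed

lemma ex_btriple_neq_0:
  assumes "bcross p q \<noteq> 0" shows "\<exists>r. btriple p q r \<noteq> 0"
proof -
  obtain r where "bdot (bcross p q) r \<noteq> 0" using ex_bdot_neq_0[OF assms] by blast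
  then have "btriple r p q \<noteq> 0" by (simp add: btriple_def bdot_commute)
  then show ?thesis using btriple_rotate(1)[of r p q] by metis
qed

lemma btriple_eq_0D:
  assumes "bcross p q \<noteq> 0" "btriple p q z = 0"
  shows "\<exists>a b. z = a *s p + b *s q"
proof -
  obtain r where "btriple p q r \<noteq> 0" using ex_btriple_neq_0[OF assms(1)] by blast
  from btriple_span[OF this, of z] assms(2) show ?thesis by auto
qed

lemma bdot_bcross_eq_btriple: "bdot (bcross p q) z = btriple p q z"
  by (simp add: coords3 algebra_simps)

lemma ex_bcross_neq_0_orthogonal:
  assumes "a \<noteq> 0" "bdot u a = 0" "u \<noteq> 0"
  shows "\<exists>b. bdot u b = 0 \<and> bcross a b \<noteq> 0"
proof -
  obtain r where r: "bdot a r = 1" using ex_bdot_eq_1[OF assms(1)] by blast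
  \<comment> \<open>The witness \<open>bcross u r\<close> is orthogonal to \<open>u\<close>; since
    \<open>a\<close> is too, only the first term of the double cross product survives.\<close>
  have "bcross a (bcross u r) = u"
    using assms(2) r by (simp add: bcross_bcross bdot_commute)
  then show ?thesis using assms(3) by (intro exI[of _ "bcross u r"]) simp
qed

lemma ex_nonzero_orthogonal: "\<exists>a. a \<noteq> 0 \<and> bdot u a = 0"
proof (cases "u = 0")
  case False
  then obtain i where i: "u $ i \<noteq> 0" by (auto simp: vec_eq_iff)
  then obtain j :: 3 where j: "j \<noteq> i" by (metis distinct_3(1))
  define a where "a = u $ j *s axis i 1 - u $ i *s (axis j 1 :: complex^3)"
  have "bdot u a = 0" by (simp add: a_def bdot_linear mult.commute)
  moreover have "a $ j \<noteq> 0" using i j by (simp add: a_def axis_def)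
  ultimately show ?thesis by (metis zero_index)
qed (auto intro: exI[of _ "axis 0 1"] simp: axis_eq_0_iff)

lemma ex_orthogonal_independent:
  assumes "a \<noteq> 0"
  shows "\<exists>b. bdot u b = 0 \<and> bcross a b \<noteq> 0"
proof -
  obtain v where v: "v \<noteq> 0" "bdot v a = 0"
    using ex_nonzero_orthogonal[of a] bdot_commute by metis
  show ?thesis
  proof (cases "u = 0 \<or> bdot u a = 0")
    case True
    \<comment> \<open>For \<open>u = 0\<close> the orthogonality condition is void, and a covector
      \<open>v\<close> annihilating \<open>a\<close> can take its place.\<close>
    define u' where "u' = (if u = 0 then v else u)"
    have "u' \<noteq> 0" "bdot u' a = 0" using True v by (auto simp: u'_def)
    from ex_bcross_neq_0_orthogonal[OF assms this(2,1)] show ?thesis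
      by (auto simp: u'_def split: if_splits)
  next
    case False
    obtain b where b: "b \<noteq> 0" "bdot u b = 0" using ex_nonzero_orthogonal by blast
    have "bcross a b \<noteq> 0"
    proof
      assume "bcross a b = 0"
      from bcross_eq_0D[OF assms this] obtain c where "b = c *s a" by blast
      with b False show False by (auto simp: bdot_linear)
    qed
    with b show ?thesis by blast
  qed
qed

lemma ex_basis_extension:
  assumes "a \<noteq> 0" shows "\<exists>b c. btriple a b c \<noteq> 0"
  using ex_orthogonal_independent[OF assms] ex_btriple_neq_0 by metis

lemma orthogonal_span:
  assumes "bcross p q \<noteq> 0" "bdot (bcross p q) z = 0"
  shows "\<exists>a b. z = a *s p + b *s q"
  using assms btriple_eq_0D by (simp add: bdot_bcross_eq_btriple)

lemma orthogonal_span':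
  assumes "u \<noteq> 0" "bdot u p = 0" "bdot u q = 0" "bcross p q \<noteq> 0" "bdot u z = 0"
  shows "\<exists>a b. z = a *s p + b *s q"
proof -
  obtain r where r: "bdot u r = 1" using ex_bdot_eq_1[OF assms(1)] by blast
  \<comment> \<open>Pairing Cramer's rule with \<open>u\<close> kills its right-hand side, because
    \<open>p\<close>, \<open>q\<close> and \<open>z\<close> are orthogonal to
    \<open>u\<close>.\<close>
  have "btriple p q z * bdot u r = bdot u (btriple p q z *s r)" by (simp add: bdot_linear)
  also have "btriple p q z *s r = btriple r q z *s p + btriple p r z *s q + btriple p q r *s z"
    by (rule btriple_cramer)
  also have "bdot u \<dots> = 0" using assms by (simp add: bdot_linear)
  finally have "btriple p q z = 0" using r by simp
  then show ?thesis using assms(4) btriple_eq_0D by blast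
qed

section \<open>Determinants as triple products\<close>

lemma det_eq_btriple: "det A = btriple (A $ 0) (A $ 1) (A $ 2)"
  by (simp add: det_3_eq coords3 algebra_simps)

text \<open>Multiplicativity of the determinant for the matrix with rows \<open>u\<close>,
  \<open>v\<close>, \<open>x\<close>. It allows singularity to be tested on chosen vectors.\<close>

lemma btriple_matrix_vector_mult:
  "btriple (K *v u) (K *v v) (K *v x) = det K * btriple u v x"
proof -
  define B :: "complex^3^3" where "B = (\<chi> i. if i = 0 then u else if i = 1 then v else x)"
  have B: "B $ 0 = u" "B $ 1 = v" "B $ 2 = x" by (simp_all add: B_def)
  have "(B ** transpose K) $ i = K *v (B $ i)" for i
    by (simp add: matrix_matrix_mult_def matrix_vector_mult_def transpose_def vec_eq_iff mult.commute)
  then have "det (B ** transpose K) = btriple (K *v u) (K *v v) (K *v x)"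
    by (simp add: det_eq_btriple B)
  then show ?thesis by (simp add: det_mul det_eq_btriple[of B] B mult.commute)
qed

lemma det_eq_0_iff_kernel:
  fixes K :: "complex^3^3"
  shows "det K = 0 \<longleftrightarrow> (\<exists>x. x \<noteq> 0 \<and> K *v x = 0)"
proof -
  have "det K \<noteq> 0 \<longleftrightarrow> (\<exists>B. B ** K = mat 1)"
    by (simp only: invertible_det_nz[symmetric] invertible_left_inverse)
  then show ?thesis by (simp only: matrix_left_invertible_ker) blast
qed

lemma bcross_linear:
  "bcross (u + v) w = bcross u w + bcross v w" "bcross w (u + v) = bcross w u + bcross w v"
  "bcross (c *s u) w = c *s bcross u w" "bcross w (c *s u) = c *s bcross w u"
  by (simp_all add: coords3 algebra_simps)

lemma bcross_simps [simp]: "bcross u u = 0" "bcross u 0 = 0"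
  by (simp_all add: coords3)

subsection \<open>Singular pencils\<close>

lemma btriple_pencil_coeffs:
  assumes "\<And>t. btriple (A + t *s C) (B + t *s D) (t *s p) = 0"
  shows "btriple A B p = 0" "btriple C B p + btriple A D p = 0" "btriple C D p = 0"
proof -
  have "t * btriple A B p + t^2 * (btriple C B p + btriple A D p) + t^3 * btriple C D p = 0" for t
    using assms[of t] by (simp add: coords3 algebra_simps power2_eq_square power3_eq_cube)
  \<comment> \<open>A cubic polynomial in \<open>t\<close> without constant term is determined by
    three nonzero values.\<close>
  from this[of 1] this[of "-1"] this[of 2] 
  show "btriple A B p = 0" "btriple C B p + btriple A D p = 0" "btriple C D p = 0"
    by simp_all algebra+
qed

text \<open>The shapes of a singular pencil with a member of rank two.  The assumption \<open>sing\<close> is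
  \<open>det (M + t N) = 0\<close> up to the factor \<open>btriple u v x\<close>; its expansion in \<open>t\<close> is evaluated on a kernel
  vector of \<open>M\<close>.\<close>

lemma singular_pencil_cases:
  fixes M N :: "complex^3^3"
  assumes detM: "det M = 0"
    and sing: "\<And>t u v x. btriple (M *v u + t *s (N *v u)) (M *v v + t *s (N *v v)) (M *v x + t *s (N *v x)) = 0"
    and rank: "bcross (M *v u0) (M *v v0) \<noteq> 0"
  obtains (right) x where "x \<noteq> 0" "M *v x = 0" "N *v x = 0"
  | (left) w where "w \<noteq> 0" "\<And>z. bdot w (M *v z) = 0" "\<And>z. bdot w (N *v z) = 0"
  | (block) c p where "c \<noteq> 0" "p \<noteq> 0" "\<And>z. bdot c z = 0 \<Longrightarrow> \<exists>a. M *v z = a *s p"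
      "\<And>z. bdot c z = 0 \<Longrightarrow> \<exists>a. N *v z = a *s p"
proof -
  obtain x where x: "x \<noteq> 0" "M *v x = 0"
    using detM det_eq_0_iff_kernel by blast
  define p where "p = N *v x"
  have "\<And>t. btriple (M *v u + t *s (N *v u)) (M *v v + t *s (N *v v)) (t *s p) = 0" for u v
    using sing[of _ _ _ x] x(2) by (simp add: p_def)
  note coeffs = btriple_pencil_coeffs[OF this]
  show thesis
  proof (cases "p = 0")
    case True
    then show thesis using right x by (simp add: p_def)
  next
    case p: False
    \<comment> \<open>The coefficient of \<open>t\<close> puts \<open>p\<close> into the image of
      \<open>M\<close>, which \<open>M *v u0\<close> and \<open>M *v v0\<close> span.\<close>
    obtain a b where "p = a *s (M *v u0) + b *s (M *v v0)"
      using btriple_eq_0D[OF rank coeffs(1)] by blast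
    then obtain u where u: "p = M *v u"
      by (metis matrix_vector_right_distrib vec.scale)
    obtain v where v: "bcross p (M *v v) \<noteq> 0"
    proof (rule ccontr)
      assume "\<not> thesis"
      then have "bcross p (M *v u0) = 0" "bcross p (M *v v0) = 0" using that by blast+
      then obtain c d where "M *v u0 = c *s p" "M *v v0 = d *s p"
        using bcross_eq_0D[OF p] by blast
      with rank show False by (simp add: bcross_linear)
    qed
    \<comment> \<open>With \<open>M *v u = p\<close>, the coefficient of \<open>t^2\<close> puts
      \<open>N *v u\<close> into the image of \<open>M\<close> as well.\<close>
    have "btriple p (N *v v) p = 0" by (simp add: btriple_rotate(2)[of p] btriple_def)
    then have "btriple p (M *v v) (N *v u) = 0"
      using coeffs(2)[of u v] u by (simp add: coords3 algebra_simps)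
    then obtain c d where cd: "N *v u = c *s p + d *s (M *v v)"
      using btriple_eq_0D[OF v] by blast
    show thesis
    proof (cases "d = 0")
      case True
      \<comment> \<open>Both \<open>M\<close> and \<open>N\<close> map the plane spanned by
        \<open>x\<close> and \<open>u\<close> into the line of \<open>p\<close>.\<close>
      have "bcross x u \<noteq> 0"
      proof
        assume "bcross x u = 0"
        then obtain k where "u = k *s x" using bcross_eq_0D[OF x(1)] by blast
        then show False using x(2) p u by (simp add: vec.scale)
      qed
      moreover have "(\<exists>a. M *v z = a *s p) \<and> (\<exists>a. N *v z = a *s p)" if z0: "bdot (bcross x u) z = 0" for z
      proof -
        obtain e f where z: "z = e *s x + f *s u"
          using orthogonal_span[OF \<open>bcross x u \<noteq> 0\<close> z0] by blast
        have "M *v z = f *s p"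
          using x(2) u by (simp add: z matrix_vector_right_distrib vec.scale)
        moreover have "N *v z = (e + f * c) *s p"
          using cd True p_def by (simp add: z matrix_vector_right_distrib vec.scale vec.scale_left_distrib)
        ultimately show ?thesis by blast
      qed
      ultimately show thesis using block p by blast
    next
      case False
      \<comment> \<open>The coefficient of \<open>t^3\<close> now puts \<open>N *v v\<close> into
        the image of \<open>M\<close>. As \<open>u\<close>, \<open>v\<close>, \<open>x\<close> form
        a basis, the image of \<open>N\<close> lies in that of \<open>M\<close>.\<close>
      have "d * btriple (M *v v) (N *v v) p = 0"
        using coeffs(3)[of u v] by (simp add: cd coords3 algebra_simps)
      then have "btriple p (M *v v) (N *v v) = 0"
        using False btriple_rotate(2) by (metis mult_eq_0_iff)
      then obtain e f where ef: "N *v v = e *s p + f *s (M *v v)"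
        using btriple_eq_0D[OF v] by blast
      have "btriple u v x \<noteq> 0"
      proof
        assume 0: "btriple u v x = 0"
        have "u \<noteq> 0" using p u by auto
        have "bcross u v \<noteq> 0"
        proof
          assume "bcross u v = 0"
          then obtain k where "v = k *s u" using bcross_eq_0D[OF \<open>u \<noteq> 0\<close>] by blast
          then show False using v u by (simp add: vec.scale bcross_linear)
        qed
        then obtain g h where gh: "x = g *s u + h *s v" using 0 btriple_eq_0D by blast
        then have 1: "0 = g *s p + h *s (M *v v)"
          using x(2) u by (simp add: matrix_vector_right_distrib vec.scale)
        have "0 = bcross p (g *s p + h *s (M *v v))" by (simp flip: 1)
        then have "h = 0" using v by (simp add: bcross_linear)
        with 1 p have "g = 0" by simp
        with gh \<open>h = 0\<close> x(1) show False by simp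
      qed
      note span = btriple_span[OF this]
      have "bdot (bcross p (M *v v)) (M *v z) = 0 \<and> bdot (bcross p (M *v v)) (N *v z) = 0" for z
        by (subst (1 2) span[of z])
          (simp add: matrix_vector_right_distrib vec.scale bdot_linear x(2) flip: u p_def,
            simp add: cd ef bdot_linear)
      then show thesis using left[OF v] by blast
    qed
  qed
qed

subsection \<open>Zero blocks\<close>

definition tri :: "(3, 3, 3) tensor3 \<Rightarrow> complex^3 \<Rightarrow> complex^3 \<Rightarrow> complex^3 \<Rightarrow> complex"
  where "tri T \<alpha> \<beta> \<gamma> = (\<Sum>i\<in>UNIV. \<Sum>j\<in>UNIV. \<Sum>k\<in>UNIV. \<alpha> $ i * \<beta> $ j * \<gamma> $ k * T $ (i, j, k))"

text \<open>Rotating the factors reduces the second and third direction to the first.\<close>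

definition cyc :: "(3, 3, 3) tensor3 \<Rightarrow> (3, 3, 3) tensor3"
  where "cyc T = vec_lambda (\<lambda>(i, j, k). T $ (k, i, j))"

definition zero_block :: "(3, 3, 3) tensor3 \<Rightarrow> bool"
  where "zero_block T \<longleftrightarrow> (\<exists>u v w. u \<noteq> 0 \<and> v \<noteq> 0 \<and> w \<noteq> 0 \<and>
    (\<forall>\<alpha> \<beta> \<gamma>. bdot u \<alpha> = 0 \<longrightarrow> bdot v \<beta> = 0 \<longrightarrow> bdot w \<gamma> = 0 \<longrightarrow> tri T \<alpha> \<beta> \<gamma> = 0))"

text \<open>Either of \<open>v\<close> and \<open>w\<close> may vanish, so the rank is at most one.
  Slices in the other directions are reached through \<open>cyc\<close>.\<close>

definition rank1_slice :: "(3, 3, 3) tensor3 \<Rightarrow> bool"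
  where "rank1_slice T \<longleftrightarrow> (\<exists>\<alpha> v w. \<alpha> \<noteq> 0 \<and> (\<forall>\<beta> \<gamma>. tri T \<alpha> \<beta> \<gamma> = bdot v \<beta> * bdot w \<gamma>))"

text \<open>The plane orthogonal to \<open>u\<close> is a projective line contained in the cubic curve.\<close>

definition vanishing_line :: "(3, 3, 3) tensor3 \<Rightarrow> bool"
  where "vanishing_line T \<longleftrightarrow> (\<exists>u. u \<noteq> 0 \<and> (\<forall>\<alpha>. bdot u \<alpha> = 0 \<longrightarrow> det_cubic0 T \<alpha> = 0))"

lemma tri_linear:
  "tri T (\<alpha> + \<alpha>') \<beta> \<gamma> = tri T \<alpha> \<beta> \<gamma> + tri T \<alpha>' \<beta> \<gamma>" "tri T (c *s \<alpha>) \<beta> \<gamma> = c * tri T \<alpha> \<beta> \<gamma>"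
  "tri T \<alpha> (\<beta> + \<beta>') \<gamma> = tri T \<alpha> \<beta> \<gamma> + tri T \<alpha> \<beta>' \<gamma>" "tri T \<alpha> (c *s \<beta>) \<gamma> = c * tri T \<alpha> \<beta> \<gamma>"
  "tri T \<alpha> \<beta> (\<gamma> + \<gamma>') = tri T \<alpha> \<beta> \<gamma> + tri T \<alpha> \<beta> \<gamma>'" "tri T \<alpha> \<beta> (c *s \<gamma>) = c * tri T \<alpha> \<beta> \<gamma>"
  by (simp_all add: tri_def distrib_left distrib_right sum.distrib sum_distrib_left mult_ac)

lemma tri_diff:
  "tri T (\<alpha> - \<alpha>') \<beta> \<gamma> = tri T \<alpha> \<beta> \<gamma> - tri T \<alpha>' \<beta> \<gamma>"
  by (simp add: tri_def left_diff_distrib sum_subtractf)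

lemma tri_cyc: "tri (cyc T) \<alpha> \<beta> \<gamma> = tri T \<gamma> \<alpha> \<beta>"
  by (simp add: tri_def cyc_def sum_3_eq algebra_simps)

lemma cyc_cyc_cyc [simp]: "cyc (cyc (cyc T)) = T"
  by (simp add: cyc_def vec_eq_iff)

lemma zero_block_cyc: "zero_block (cyc T) \<longleftrightarrow> zero_block T"
  unfolding zero_block_def tri_cyc by blast

lemma det_cubic1_eq_cyc: "det_cubic1 T = det_cubic0 (cyc T)"
proof
  fix \<alpha>
  have "contract0 (cyc T) \<alpha> = transpose (contract1 T \<alpha>)"
    by (simp add: contract0_def contract1_def cyc_def transpose_def vec_eq_iff)
  then show "det_cubic1 T \<alpha> = det_cubic0 (cyc T) \<alpha>"
    by (simp add: det_cubic1_def det_cubic0_def)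
qed

lemma det_cubic2_eq_cyc: "det_cubic2 T = det_cubic0 (cyc (cyc T))"
  by (simp add: fun_eq_iff det_cubic2_def det_cubic0_def contract0_def contract2_def cyc_def)

section \<open>Slices of low rank and singular pencils of slices\<close>

lemma tri_eq_contract0: "tri T \<alpha> \<beta> \<gamma> = bdot \<beta> (contract0 T \<alpha> *v \<gamma>)"
  by (simp add: tri_def contract0_def matrix_vector_mult_def coords3 algebra_simps)

lemma tri_sum_axis2: "tri T \<alpha> \<beta> \<gamma> = bdot (\<chi> j. tri T \<alpha> (axis j 1) \<gamma>) \<beta>"
  by (simp add: tri_eq_contract0 vec_lambda_eta bdot_commute)

lemma tri_sum_axis3: "tri T \<alpha> \<beta> \<gamma> = bdot (\<chi> k. tri T \<alpha> \<beta> (axis k 1)) \<gamma>"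
  using tri_sum_axis2[of "cyc T" \<beta> \<gamma> \<alpha>] by (simp add: tri_cyc)

lemma contract0_add: "contract0 T (\<alpha> + t *s \<alpha>') *v z = contract0 T \<alpha> *v z + t *s (contract0 T \<alpha>' *v z)"
  by (simp add: contract0_def matrix_vector_mult_def coords3 algebra_simps)

text \<open>A slice that vanishes for \<alpha> in the plane of \<open>u\<close> depends on \<alpha>
  only through \<open>bdot u \<alpha>\<close>, so it is a product of two linear forms.\<close>

lemma rank1_slice3_if_vanishing:
  assumes "\<gamma> \<noteq> 0" "u \<noteq> 0" "\<And>\<alpha> \<beta>. bdot u \<alpha> = 0 \<Longrightarrow> tri T \<alpha> \<beta> \<gamma> = 0"
  shows "rank1_slice (cyc (cyc T))"
proof -
  obtain a where a: "bdot u a = 1" using ex_bdot_eq_1[OF assms(2)] by blast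
  have "tri T \<alpha> \<beta> \<gamma> = bdot u \<alpha> * tri T a \<beta> \<gamma>" for \<alpha> \<beta>
  proof -
    have "bdot u (\<alpha> - bdot u \<alpha> *s a) = 0" using a by (simp add: bdot_linear)
    from assms(3)[OF this, of \<beta>] show ?thesis by (simp add: tri_diff tri_linear)
  qed
  then have "tri T \<alpha> \<beta> \<gamma> = bdot u \<alpha> * bdot (\<chi> j. tri T a (axis j 1) \<gamma>) \<beta>" for \<alpha> \<beta>
    by (metis tri_sum_axis2)
  then show ?thesis unfolding rank1_slice_def tri_cyc using assms(1) by blast
qed

lemma rank1_slice2_if_vanishing:
  assumes "\<beta> \<noteq> 0" "u \<noteq> 0" "\<And>\<alpha> \<gamma>. bdot u \<alpha> = 0 \<Longrightarrow> tri T \<alpha> \<beta> \<gamma> = 0"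
  shows "rank1_slice (cyc T)"
proof -
  obtain a where a: "bdot u a = 1" using ex_bdot_eq_1[OF assms(2)] by blast
  have "tri T \<alpha> \<beta> \<gamma> = bdot u \<alpha> * tri T a \<beta> \<gamma>" for \<alpha> \<gamma>
  proof -
    have "bdot u (\<alpha> - bdot u \<alpha> *s a) = 0" using a by (simp add: bdot_linear)
    from assms(3)[OF this, of \<gamma>] show ?thesis by (simp add: tri_diff tri_linear)
  qed
  then have "tri T \<alpha> \<beta> \<gamma> = bdot (\<chi> k. tri T a \<beta> (axis k 1)) \<gamma> * bdot u \<alpha>" for \<alpha> \<gamma>
    by (metis tri_sum_axis3 mult.commute)
  then show ?thesis unfolding rank1_slice_def tri_cyc using assms(1) by blast
qed

text \<open>If some slice over the plane of \<open>u\<close> has rank two, the cases of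
  \<open>singular_pencil_cases\<close> give the three alternatives. Otherwise all these slices have
  rank at most one, and such a space of matrices yields a zero block.\<close>

lemma vanishing_line_cases:
  assumes "vanishing_line T"
  shows "zero_block T \<or> rank1_slice (cyc T) \<or> rank1_slice (cyc (cyc T))"
proof -
  obtain u where u: "u \<noteq> 0" and det: "\<And>\<alpha>. bdot u \<alpha> = 0 \<Longrightarrow> det (contract0 T \<alpha>) = 0"
    using assms by (auto simp: vanishing_line_def det_cubic0_def)
  show ?thesis
  proof (cases "\<exists>\<alpha> y z. bdot u \<alpha> = 0 \<and> bcross (contract0 T \<alpha> *v y) (contract0 T \<alpha> *v z) \<noteq> 0")
    case True
    then obtain \<alpha>1 y z where 1: "bdot u \<alpha>1 = 0"
      and rank: "bcross (contract0 T \<alpha>1 *v y) (contract0 T \<alpha>1 *v z) \<noteq> 0" by blast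
    have "\<alpha>1 \<noteq> 0" using rank by (auto simp: contract0_def matrix_vector_mult_def coords3)
    then obtain \<alpha>2 where 2: "bdot u \<alpha>2 = 0" "bcross \<alpha>1 \<alpha>2 \<noteq> 0"
      using ex_bcross_neq_0_orthogonal[OF _ 1 u] by blast
    have span: "\<exists>s t. \<alpha> = s *s \<alpha>1 + t *s \<alpha>2" if "bdot u \<alpha> = 0" for \<alpha>
      using orthogonal_span'[OF u 1 2 that] .
    have sing: "btriple (contract0 T \<alpha>1 *v u' + t *s (contract0 T \<alpha>2 *v u'))
        (contract0 T \<alpha>1 *v v' + t *s (contract0 T \<alpha>2 *v v'))
        (contract0 T \<alpha>1 *v x' + t *s (contract0 T \<alpha>2 *v x')) = 0" for t u' v' x'
      using det[of "\<alpha>1 + t *s \<alpha>2"] 1 2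
      by (simp add: bdot_linear btriple_matrix_vector_mult flip: contract0_add)
    from det[OF 1] sing rank show ?thesis
    proof (cases rule: singular_pencil_cases)
      case (right x)
      have "tri T \<alpha> \<beta> x = 0" if "bdot u \<alpha> = 0" for \<alpha> \<beta>
      proof -
        have "tri T \<alpha>1 \<beta> x = 0" "tri T \<alpha>2 \<beta> x = 0" using right by (simp_all add: tri_eq_contract0)
        with span[OF that] show ?thesis by (auto simp: tri_linear)
      qed
      then show ?thesis using rank1_slice3_if_vanishing right(1) u by blast
    next
      case (left w)
      have "tri T \<alpha> w \<gamma> = 0" if "bdot u \<alpha> = 0" for \<alpha> \<gamma>
      proof -
        have "tri T \<alpha>1 w \<gamma> = 0" "tri T \<alpha>2 w \<gamma> = 0" using left by (simp_all add: tri_eq_contract0)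
        with span[OF that] show ?thesis by (auto simp: tri_linear)
      qed
      then show ?thesis using rank1_slice2_if_vanishing left(1) u by blast
    next
      case (block c p)
      have "tri T \<alpha> \<beta> \<gamma> = 0" if "bdot u \<alpha> = 0" "bdot p \<beta> = 0" "bdot c \<gamma> = 0" for \<alpha> \<beta> \<gamma>
      proof -
        have "tri T \<alpha>1 \<beta> \<gamma> = 0" "tri T \<alpha>2 \<beta> \<gamma> = 0"
          using block(3,4)[OF that(3)] that(2) bdot_commute[of p]
          by (auto simp: tri_eq_contract0 bdot_linear)
        with span[OF that(1)] show ?thesis by (auto simp: tri_linear)
      qed
      then show ?thesis unfolding zero_block_def using block(1,2) u by blast
    qed
  next
    case False
    then have rank1: "bcross (contract0 T \<alpha> *v y) (contract0 T \<alpha> *v z) = 0" if "bdot u \<alpha> = 0" for \<alpha> y z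
      using that by blast
    show ?thesis
    proof (cases "\<exists>\<alpha> \<gamma>. bdot u \<alpha> = 0 \<and> contract0 T \<alpha> *v \<gamma> \<noteq> 0")
      case True
      then obtain \<alpha>1 \<gamma>1 where 1: "bdot u \<alpha>1 = 0" "contract0 T \<alpha>1 *v \<gamma>1 \<noteq> 0" by blast
      define p where "p = contract0 T \<alpha>1 *v \<gamma>1"
      have p: "p \<noteq> 0" using 1 by (simp add: p_def)
      obtain q where q: "bdot q p = 1" using ex_bdot_eq_1[OF p] bdot_commute by metis
      \<comment> \<open>The slice at \<alpha>1 has rank one: it is the column \<open>p\<close> times
        the row \<open>c\<close>.\<close>
      define c where "c = (\<chi> k. tri T \<alpha>1 q (axis k 1))"
      have c: "bdot c \<gamma> = tri T \<alpha>1 q \<gamma>" for \<gamma>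
        using tri_sum_axis3[of T \<alpha>1 q \<gamma>] by (simp add: c_def)
      have "bdot c \<gamma>1 = 1" using q by (simp add: c tri_eq_contract0 flip: p_def)
      then have "c \<noteq> 0" by auto
      have "tri T \<alpha> \<beta> \<gamma> = 0" if \<alpha>: "bdot u \<alpha> = 0" and \<beta>: "bdot p \<beta> = 0" and \<gamma>: "bdot c \<gamma> = 0" for \<alpha> \<beta> \<gamma>
      proof -
        have "bcross p (contract0 T \<alpha>1 *v \<gamma>) = 0" using rank1[OF 1(1)] by (simp add: p_def)
        then obtain k where k: "contract0 T \<alpha>1 *v \<gamma> = k *s p" using bcross_eq_0D[OF p] by blast
        with \<gamma> q have "k = 0" by (simp add: c tri_eq_contract0 bdot_linear)
        with k have 0: "contract0 T \<alpha>1 *v \<gamma> = 0" by simp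
        \<comment> \<open>The sum of the two slices also has rank at most one. As the slice at
          \<alpha>1 kills \<gamma>, its minor on \<gamma>1 and \<gamma> forces the slice at \<alpha>
          to send \<gamma> into the line of \<open>p\<close>.\<close>
        have "bdot u (\<alpha>1 + 1 *s \<alpha>) = 0" using 1 \<alpha> by (simp add: bdot_linear)
        from rank1[OF this, of \<gamma>1 \<gamma>] rank1[OF \<alpha>, of \<gamma>1 \<gamma>]
        have "bcross p (contract0 T \<alpha> *v \<gamma>) = 0"
          unfolding contract0_add by (simp add: 0 bcross_linear flip: p_def)
        then obtain l where "contract0 T \<alpha> *v \<gamma> = l *s p" using bcross_eq_0D[OF p] by blast
        then show ?thesis using \<beta> by (simp add: tri_eq_contract0 bdot_linear bdot_commute)
      qed
      then show ?thesis unfolding zero_block_def using u p \<open>c \<noteq> 0\<close> by blast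
    next
      case False
      then have "zero_block T"
        unfolding zero_block_def tri_eq_contract0 using u by (metis bdot_zero(2))
      then show ?thesis ..
    qed
  qed
qed

section \<open>From slices of rank at most one to a zero block\<close>

lemma binary_quadratic_root:
  fixes a b c :: complex
  shows "\<exists>s t. (s, t) \<noteq> (0, 0) \<and> a * s\<^sup>2 + b * (s * t) + c * t\<^sup>2 = 0"
proof (cases "a = 0")
  case True
  then show ?thesis by (intro exI[of _ 1] exI[of _ 0]) simp
next
  case False
  define d where "d = csqrt (b\<^sup>2 - 4 * a * c)"
  define s where "s = (- b + d) / (2 * a)"
  have "d\<^sup>2 = b\<^sup>2 - 4 * a * c" by (simp add: d_def)
  moreover have d: "d = 2 * a * s + b" using False by (simp add: s_def)
  ultimately have "4 * a * (a * s\<^sup>2 + b * s + c) = 0" unfolding d by algebra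
  then have "a * s\<^sup>2 + b * s + c = 0" using False by simp
  then show ?thesis by (intro exI[of _ s] exI[of _ 1]) simp
qed

lemma singular_2x2_kernel:
  fixes a b c d :: complex
  assumes "a * d = b * c"
  shows "\<exists>p q. (p, q) \<noteq> (0, 0) \<and> a * p + b * q = 0 \<and> c * p + d * q = 0"
proof (cases "a = 0 \<and> b = 0")
  case True
  show ?thesis
  proof (cases "c = 0 \<and> d = 0")
    case True
    then show ?thesis using \<open>a = 0 \<and> b = 0\<close> by (intro exI[of _ 1] exI[of _ 0]) auto
  next
    case False
    then show ?thesis using True by (intro exI[of _ d] exI[of _ "-c"]) (auto simp: algebra_simps)
  qed
next
  case False
  then show ?thesis using assms by (intro exI[of _ b] exI[of _ "-a"]) (auto simp: algebra_simps)
qed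

text \<open>The slices share their column space, which leaves a pencil of \<open>2 \<times> 2\<close> matrices; a root of its
  determinant provides the block.\<close>

lemma zero_block_if_common_factor:
  assumes \<alpha>0: "\<alpha>0 \<noteq> 0" and \<beta>0: "\<beta>0 \<noteq> 0" and w: "w \<noteq> 0"
    and z1: "\<And>\<beta> \<gamma>. bdot w \<gamma> = 0 \<Longrightarrow> tri T \<alpha>0 \<beta> \<gamma> = 0"
    and z2: "\<And>\<alpha> \<gamma>. bdot w \<gamma> = 0 \<Longrightarrow> tri T \<alpha> \<beta>0 \<gamma> = 0"
  shows "zero_block T"
proof -
  obtain \<alpha>1 \<alpha>2 where \<alpha>: "btriple \<alpha>0 \<alpha>1 \<alpha>2 \<noteq> 0" using ex_basis_extension[OF \<alpha>0] by blast
  obtain \<beta>1 \<beta>2 where \<beta>: "btriple \<beta>0 \<beta>1 \<beta>2 \<noteq> 0" using ex_basis_extension[OF \<beta>0] by blast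
  obtain \<gamma>1 where \<gamma>1: "\<gamma>1 \<noteq> 0" "bdot w \<gamma>1 = 0" using ex_nonzero_orthogonal by blast
  obtain \<gamma>2 where \<gamma>2: "bdot w \<gamma>2 = 0" "bcross \<gamma>1 \<gamma>2 \<noteq> 0"
    using ex_bcross_neq_0_orthogonal[OF \<gamma>1 w] by blast
  define f where "f \<alpha> \<beta> = tri T \<alpha> \<beta> \<gamma>1" for \<alpha> \<beta>
  define g where "g \<alpha> \<beta> = tri T \<alpha> \<beta> \<gamma>2" for \<alpha> \<beta>
  \<comment> \<open>The quadratic form in \<open>s\<close> and \<open>t\<close> is the determinant
    of the matrix of \<open>f\<close> and \<open>g\<close> at
    \<open>s *s \<alpha>1 + t *s \<alpha>2\<close> against \<beta>1 and \<beta>2.\<close>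
  obtain s t where st: "(s, t) \<noteq> (0, 0)"
    and root: "(f \<alpha>1 \<beta>1 * g \<alpha>1 \<beta>2 - f \<alpha>1 \<beta>2 * g \<alpha>1 \<beta>1) * s\<^sup>2
      + (f \<alpha>1 \<beta>1 * g \<alpha>2 \<beta>2 + f \<alpha>2 \<beta>1 * g \<alpha>1 \<beta>2 - f \<alpha>1 \<beta>2 * g \<alpha>2 \<beta>1 - f \<alpha>2 \<beta>2 * g \<alpha>1 \<beta>1) * (s * t)
      + (f \<alpha>2 \<beta>1 * g \<alpha>2 \<beta>2 - f \<alpha>2 \<beta>2 * g \<alpha>2 \<beta>1) * t\<^sup>2 = 0"
    using binary_quadratic_root by blast
  define \<alpha>' where "\<alpha>' = s *s \<alpha>1 + t *s \<alpha>2"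
  have "f \<alpha>' \<beta>1 * g \<alpha>' \<beta>2 = f \<alpha>' \<beta>2 * g \<alpha>' \<beta>1"
    using root by (simp add: \<alpha>'_def f_def g_def tri_linear) algebra
  then obtain p q where pq: "(p, q) \<noteq> (0, 0)"
    and ker: "f \<alpha>' \<beta>1 * p + f \<alpha>' \<beta>2 * q = 0" "g \<alpha>' \<beta>1 * p + g \<alpha>' \<beta>2 * q = 0"
    using singular_2x2_kernel by blast
  define \<beta>' where "\<beta>' = p *s \<beta>1 + q *s \<beta>2"
  have indep: "bcross a0 (x *s a1 + y *s a2) \<noteq> 0"
    if a: "btriple a0 a1 a2 \<noteq> 0" and xy: "(x, y) \<noteq> (0, 0)" for a0 a1 a2 and x y :: complex
  proof
    assume 0: "bcross a0 (x *s a1 + y *s a2) = 0"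
    have "y * btriple a0 a1 a2 = - bdot a1 (bcross a0 (x *s a1 + y *s a2))"
      "x * btriple a0 a1 a2 = bdot a2 (bcross a0 (x *s a1 + y *s a2))"
      by (simp_all add: coords3 algebra_simps)
    with 0 a xy show False by simp
  qed
  have "tri T x y z = 0" if x: "bdot (bcross \<alpha>0 \<alpha>') x = 0" and y: "bdot (bcross \<beta>0 \<beta>') y = 0"
    and z: "bdot w z = 0" for x y z
  proof -
    obtain a a' where x': "x = a *s \<alpha>0 + a' *s \<alpha>'"
      using orthogonal_span[OF indep[OF \<alpha> st] x[unfolded \<alpha>'_def]] by (auto simp: \<alpha>'_def)
    obtain b b' where y': "y = b *s \<beta>0 + b' *s \<beta>'"
      using orthogonal_span[OF indep[OF \<beta> pq] y[unfolded \<beta>'_def]] by (auto simp: \<beta>'_def)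
    obtain c c' where z': "z = c *s \<gamma>1 + c' *s \<gamma>2"
      using orthogonal_span'[OF w \<gamma>1(2) \<gamma>2 z] by blast
    \<comment> \<open>The products involving \<alpha>0 or \<beta>0 already vanish by
      \<open>z1\<close> and \<open>z2\<close>.\<close>
    have "tri T \<alpha>' \<beta>' \<gamma>1 = 0" "tri T \<alpha>' \<beta>' \<gamma>2 = 0"
      using ker by (simp_all add: \<beta>'_def f_def g_def tri_linear mult.commute)
    then show ?thesis by (simp add: x' y' z' tri_linear z1 z2 \<gamma>1 \<gamma>2)
  qed
  then show ?thesis unfolding zero_block_def
    using indep[OF \<alpha> st] indep[OF \<beta> pq] w unfolding \<alpha>'_def \<beta>'_def by blast
qed

text \<open>The two slices share the values at \<alpha>0 and \<beta>0, which ties \<open>w\<close>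
  to \<open>w'\<close>. If the common form vanishes through both scalars, \<alpha>' and \<beta>' can
  be chosen in the kernels of \<open>u\<close> and \<open>v\<close>, and only their form in \<gamma>
  remains to be killed. Otherwise one of \<open>w\<close>, \<open>w'\<close> is a multiple of the
  other, and the slices have a common factor.\<close>

lemma zero_block_if_two_rank1_slices:
  assumes "rank1_slice T" "rank1_slice (cyc T)"
  shows "zero_block T"
proof -
  obtain \<alpha>0 v w where \<alpha>0: "\<alpha>0 \<noteq> 0" "\<And>\<beta> \<gamma>. tri T \<alpha>0 \<beta> \<gamma> = bdot v \<beta> * bdot w \<gamma>"
    using assms(1) by (auto simp: rank1_slice_def)
  obtain \<beta>0 w' u where \<beta>0: "\<beta>0 \<noteq> 0" "\<And>\<alpha> \<gamma>. tri T \<alpha> \<beta>0 \<gamma> = bdot w' \<gamma> * bdot u \<alpha>"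
    using assms(2) by (auto simp: rank1_slice_def tri_cyc)
  have eq: "bdot v \<beta>0 * bdot w \<gamma> = bdot w' \<gamma> * bdot u \<alpha>0" for \<gamma>
    using \<alpha>0(2) \<beta>0(2) by metis
  \<comment> \<open>A default normal for the cases in which the required covector is zero and any
    plane will do.\<close>
  define e :: "complex^3" where "e = axis 0 1"
  have e: "e \<noteq> 0" by (simp add: e_def axis_eq_0_iff)
  consider "bdot v \<beta>0 = 0" "bdot u \<alpha>0 = 0" | "bdot v \<beta>0 \<noteq> 0" | "bdot u \<alpha>0 \<noteq> 0" by blast
  then show ?thesis
  proof cases
    case 1
    obtain \<alpha>' where \<alpha>': "bdot u \<alpha>' = 0" "bcross \<alpha>0 \<alpha>' \<noteq> 0"
      using ex_orthogonal_independent[OF \<alpha>0(1)] by blast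
    obtain \<beta>' where \<beta>': "bdot v \<beta>' = 0" "bcross \<beta>0 \<beta>' \<noteq> 0"
      using ex_orthogonal_independent[OF \<beta>0(1)] by blast
    define d where "d = (\<chi> k. tri T \<alpha>' \<beta>' (axis k 1))"
    have d: "tri T \<alpha>' \<beta>' \<gamma> = bdot d \<gamma>" for \<gamma> unfolding d_def by (rule tri_sum_axis3)
    define d' where "d' = (if d = 0 then e else d)"
    have d': "d' \<noteq> 0" "bdot d' \<gamma> = 0 \<Longrightarrow> bdot d \<gamma> = 0" for \<gamma> using e by (auto simp: d'_def split: if_splits)
    have "tri T x y z = 0" if x: "bdot (bcross \<alpha>0 \<alpha>') x = 0" and y: "bdot (bcross \<beta>0 \<beta>') y = 0"
      and z: "bdot d' z = 0" for x y z
    proof -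
      obtain a a' b b' where "x = a *s \<alpha>0 + a' *s \<alpha>'" "y = b *s \<beta>0 + b' *s \<beta>'"
        using orthogonal_span[OF \<alpha>'(2) x] orthogonal_span[OF \<beta>'(2) y] by blast
      then show ?thesis using 1 \<alpha>' \<beta>' d'(2)[OF z] by (simp add: tri_linear \<alpha>0 \<beta>0 d)
    qed
    then show ?thesis unfolding zero_block_def using \<alpha>' \<beta>' d' by blast
  next
    case 2
    define w'' where "w'' = (if w' = 0 then e else w')"
    have w'': "w'' \<noteq> 0" "bdot w'' \<gamma> = 0 \<Longrightarrow> bdot w' \<gamma> = 0" for \<gamma> using e by (auto simp: w''_def split: if_splits)
    then have "bdot w \<gamma> = 0" if "bdot w'' \<gamma> = 0" for \<gamma> using eq[of \<gamma>] 2 that by auto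
    then show ?thesis
      using w'' by (intro zero_block_if_common_factor[OF \<alpha>0(1) \<beta>0(1) w''(1)]) (auto simp: \<alpha>0 \<beta>0)
  next
    case 3
    define w'' where "w'' = (if w = 0 then e else w)"
    have w'': "w'' \<noteq> 0" "bdot w'' \<gamma> = 0 \<Longrightarrow> bdot w \<gamma> = 0" for \<gamma> using e by (auto simp: w''_def split: if_splits)
    then have "bdot w' \<gamma> = 0" if "bdot w'' \<gamma> = 0" for \<gamma> using eq[of \<gamma>] 3 that by auto
    then show ?thesis
      using w'' by (intro zero_block_if_common_factor[OF \<alpha>0(1) \<beta>0(1) w''(1)]) (auto simp: \<alpha>0 \<beta>0)
  qed
qed

text \<open>Each line excludes its own direction, so the slices found cannot all lie in one
  direction; any two of the three directions are cyclically adjacent.\<close>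

lemma zero_block_if_vanishing_lines:
  assumes "vanishing_line T" "vanishing_line (cyc T)" "vanishing_line (cyc (cyc T))"
  shows "zero_block T"
  using assms[THEN vanishing_line_cases] zero_block_if_two_rank1_slices[of T]
    zero_block_if_two_rank1_slices[of "cyc T"] zero_block_if_two_rank1_slices[of "cyc (cyc T)"]
  unfolding zero_block_cyc cyc_cyc_cyc by blast

subsection \<open>Reducible cubics\<close>

lemma linear_form_iff: "linear_form l \<longleftrightarrow> (\<exists>u. \<forall>\<alpha>. l \<alpha> = bdot u \<alpha>)"
  by (simp add: linear_form_def bdot_def)

lemma linear_form_bdot: "linear_form (\<lambda>\<alpha>. bdot u \<alpha>)"
  by (auto simp: linear_form_iff)

lemma linear_form_diff:
  assumes "linear_form l" "linear_form m" shows "linear_form (\<lambda>\<alpha>. l \<alpha> - m \<alpha>)"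
  using assms unfolding linear_form_iff by (metis bdot_linear(5))

lemma linear_form_add:
  assumes "linear_form l" "linear_form m" shows "linear_form (\<lambda>\<alpha>. l \<alpha> + m \<alpha>)"
  using assms unfolding linear_form_iff by (metis bdot_linear(4))

lemma linear_form_cmult:
  assumes "linear_form l" shows "linear_form (\<lambda>\<alpha>. c * l \<alpha>)"
  using assms unfolding linear_form_iff by (metis bdot_linear(6))

lemma linear_form_cmult':
  assumes "linear_form l" shows "linear_form (\<lambda>\<alpha>. l \<alpha> * c)"
  using linear_form_cmult[OF assms, of c] by (simp add: mult.commute)

lemma quadratic_form_mult:
  assumes "linear_form l" "linear_form m" shows "quadratic_form (\<lambda>\<alpha>. l \<alpha> * m \<alpha>)"
proof -
  obtain u v where "\<And>\<alpha>. l \<alpha> = bdot u \<alpha>" "\<And>\<alpha>. m \<alpha> = bdot v \<alpha>"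
    using assms unfolding linear_form_iff by blast
  then show ?thesis unfolding quadratic_form_def
    by (intro exI[of _ "\<chi> i j. u $ i * v $ j"]) (simp add: bdot_def sum_product mult_ac)
qed

lemma quadratic_form_add:
  assumes "quadratic_form p" "quadratic_form q" shows "quadratic_form (\<lambda>\<alpha>. p \<alpha> + q \<alpha>)"
proof -
  obtain A B :: "complex^3^3" where "\<And>\<alpha>. p \<alpha> = (\<Sum>i\<in>UNIV. \<Sum>j\<in>UNIV. A $ i $ j * \<alpha> $ i * \<alpha> $ j)"
    "\<And>\<alpha>. q \<alpha> = (\<Sum>i\<in>UNIV. \<Sum>j\<in>UNIV. B $ i $ j * \<alpha> $ i * \<alpha> $ j)"
    using assms unfolding quadratic_form_def by blast
  then show ?thesis unfolding quadratic_form_def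
    by (intro exI[of _ "A + B"]) (simp add: distrib_right sum.distrib)
qed

lemma quadratic_form_diff:
  assumes "quadratic_form p" "quadratic_form q" shows "quadratic_form (\<lambda>\<alpha>. p \<alpha> - q \<alpha>)"
proof -
  obtain A B :: "complex^3^3" where "\<And>\<alpha>. p \<alpha> = (\<Sum>i\<in>UNIV. \<Sum>j\<in>UNIV. A $ i $ j * \<alpha> $ i * \<alpha> $ j)"
    "\<And>\<alpha>. q \<alpha> = (\<Sum>i\<in>UNIV. \<Sum>j\<in>UNIV. B $ i $ j * \<alpha> $ i * \<alpha> $ j)"
    using assms unfolding quadratic_form_def by blast
  then show ?thesis unfolding quadratic_form_def
    by (intro exI[of _ "A - B"]) (simp add: left_diff_distrib sum_subtractf)
qed

text \<open>The derivative of the determinant at \<open>B\<close> in the direction \<open>A\<close>.\<close>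

definition mixed_det :: "complex^3^3 \<Rightarrow> complex^3^3 \<Rightarrow> complex"
  where "mixed_det A B =
      A$0$0 * (B$1$1 * B$2$2 - B$1$2 * B$2$1) - A$0$1 * (B$1$0 * B$2$2 - B$1$2 * B$2$0)
    + A$0$2 * (B$1$0 * B$2$1 - B$1$1 * B$2$0) + A$1$0 * (B$0$2 * B$2$1 - B$0$1 * B$2$2)
    + A$1$1 * (B$0$0 * B$2$2 - B$0$2 * B$2$0) + A$1$2 * (B$0$1 * B$2$0 - B$0$0 * B$2$1)
    + A$2$0 * (B$0$1 * B$1$2 - B$0$2 * B$1$1) + A$2$1 * (B$0$2 * B$1$0 - B$0$0 * B$1$2)
    + A$2$2 * (B$0$0 * B$1$1 - B$0$1 * B$1$0)"

text \<open>Arranged so that the factor \<open>s\<close> splits off as soon as \<open>det B\<close>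
  vanishes.\<close>

lemma det_pencil:
  fixes A B :: "complex^3^3"
  shows "det (\<chi> i j. s * A$i$j + B$i$j)
    = s * (s * (det A * s) + s * mixed_det B A + mixed_det A B) + det B"
  by (simp add: det_3_eq mixed_det_def) algebra

text \<open>Splitting \<alpha> into a multiple of \<open>a\<close> and a vector in the plane of
  \<open>u\<close> writes the contraction as \<open>bdot u \<alpha>\<close> times \<open>A\<close>
  plus a singular matrix, so \<open>bdot u \<alpha>\<close> divides the determinant. In the other
  direction a zero linear factor means a zero cubic, and any plane will do.\<close>

lemma reducible_iff_vanishing_line: "reducible_cubic (det_cubic0 T) \<longleftrightarrow> vanishing_line T"
proof
  assume "reducible_cubic (det_cubic0 T)"
  then obtain u q where uq: "\<And>\<alpha>. det_cubic0 T \<alpha> = bdot u \<alpha> * q \<alpha>"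
    unfolding reducible_cubic_def linear_form_iff by metis
  show "vanishing_line T"
  proof (cases "u = 0")
    case True
    then show ?thesis unfolding vanishing_line_def
      by (intro exI[of _ "axis 0 1"]) (simp add: uq axis_eq_0_iff)
  next
    case False
    then show ?thesis unfolding vanishing_line_def by (intro exI[of _ u]) (simp add: uq)
  qed
next
  assume "vanishing_line T"
  then obtain u where u: "u \<noteq> 0" and det: "\<And>\<alpha>. bdot u \<alpha> = 0 \<Longrightarrow> det (contract0 T \<alpha>) = 0"
    by (auto simp: vanishing_line_def det_cubic0_def)
  obtain a where a: "bdot u a = 1" using ex_bdot_eq_1[OF u] by blast
  define A where "A = contract0 T a"
  define B where "B \<alpha> = contract0 T (\<alpha> - bdot u \<alpha> *s a)" for \<alpha>
  define q where "q \<alpha> = bdot u \<alpha> * (det A * bdot u \<alpha>) + bdot u \<alpha> * mixed_det (B \<alpha>) A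
    + mixed_det A (B \<alpha>)" for \<alpha>
  have B: "linear_form (\<lambda>\<alpha>. B \<alpha> $ j $ k)" for j k
  proof -
    have "B \<alpha> $ j $ k = bdot (\<chi> i. T $ (i, j, k)) \<alpha> - A $ j $ k * bdot u \<alpha>" for \<alpha>
      by (simp add: B_def A_def contract0_def coords3 algebra_simps)
    then show ?thesis
      by (simp only:) (intro linear_form_diff linear_form_cmult linear_form_bdot)
  qed
  have "quadratic_form q"
    unfolding q_def mixed_det_def
    by (simp only: right_diff_distrib[of "A $ _ $ _"] mult.assoc[symmetric])
      (intro quadratic_form_add quadratic_form_diff quadratic_form_mult linear_form_add
        linear_form_diff linear_form_cmult linear_form_cmult' linear_form_bdot B)
  moreover have "det_cubic0 T \<alpha> = bdot u \<alpha> * q \<alpha>" for \<alpha>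
  proof -
    have "contract0 T \<alpha> = (\<chi> j k. bdot u \<alpha> * A $ j $ k + B \<alpha> $ j $ k)"
      by (simp add: A_def B_def contract0_def coords3 algebra_simps)
    moreover have "det (B \<alpha>) = 0"
      unfolding B_def by (rule det) (simp add: bdot_linear a)
    ultimately show ?thesis by (simp add: det_cubic0_def q_def det_pencil)
  qed
  ultimately show "reducible_cubic (det_cubic0 T)"
    unfolding reducible_cubic_def using linear_form_bdot by blast
qed

text \<open>Prepares a compactness argument: \<open>u\<close> is normalised, and its plane is
  parametrised by \<open>bcross u\<close>, which makes the conditions continuous equations in
  \<open>T\<close> and \<open>u\<close>.\<close>

lemma vanishing_line_iff_sphere:
  "vanishing_line T \<longleftrightarrow> (\<exists>u\<in>sphere 0 1. \<forall>\<beta>. det_cubic0 T (bcross u \<beta>) = 0)"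
proof
  assume "vanishing_line T"
  then obtain u where u: "u \<noteq> 0" "\<And>\<alpha>. bdot u \<alpha> = 0 \<Longrightarrow> det_cubic0 T \<alpha> = 0"
    unfolding vanishing_line_def by blast
  define v where "v = inverse (norm u) *\<^sub>R u"
  have "bdot u (bcross v \<beta>) = 0" for \<beta>
    by (simp add: v_def coords3) (simp add: scaleR_conv_of_real algebra_simps)
  moreover have "norm v = 1" using u by (simp add: v_def)
  ultimately show "\<exists>u\<in>sphere 0 1. \<forall>\<beta>. det_cubic0 T (bcross u \<beta>) = 0"
    using u(2) by (intro bexI[of _ v]) simp_all
next
  assume "\<exists>u\<in>sphere 0 1. \<forall>\<beta>. det_cubic0 T (bcross u \<beta>) = 0"
  then obtain u where u: "u \<in> sphere 0 1" "\<And>\<beta>. det_cubic0 T (bcross u \<beta>) = 0" by blast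
  then have "u \<noteq> 0" by auto
  moreover have "det_cubic0 T \<alpha> = 0" if "bdot u \<alpha> = 0" for \<alpha>
  proof -
    obtain r where "bdot u r = 1" using ex_bdot_eq_1[OF \<open>u \<noteq> 0\<close>] by blast
    then have "bcross u (bcross \<alpha> r) = \<alpha>" using that by (simp add: bcross_bcross)
    then show ?thesis using u(2) by metis
  qed
  ultimately show "vanishing_line T" unfolding vanishing_line_def by blast
qed

text \<open>Unit normals of a convergent sequence of tensors have a limit point on the sphere, and
  the equations pass to the limit.\<close>

lemma closed_vanishing_line: "closed {T. vanishing_line T}"
  unfolding closed_sequential_limits
proof (intro allI impI, elim conjE)
  fix X T assume X: "\<forall>n. X n \<in> {T. vanishing_line T}" and lim: "X \<longlonglongrightarrow> T"
  then have "\<forall>n. \<exists>u\<in>sphere 0 1. \<forall>\<beta>. det_cubic0 (X n) (bcross u \<beta>) = 0"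
    by (simp add: vanishing_line_iff_sphere)
  then obtain U where U: "\<And>n. U n \<in> sphere 0 1" "\<And>n \<beta>. det_cubic0 (X n) (bcross (U n) \<beta>) = 0"
    by metis
  obtain u r where u: "u \<in> sphere 0 1" "strict_mono r" "(U \<circ> r) \<longlonglongrightarrow> u"
    using compact_sphere[of 0 1] U(1) unfolding compact_def by metis
  have "(\<lambda>n. det_cubic0 ((X \<circ> r) n) (bcross ((U \<circ> r) n) \<beta>)) \<longlonglongrightarrow> det_cubic0 T (bcross u \<beta>)" for \<beta>
    unfolding det_cubic0_def det_3_eq contract0_def sum_3_eq vec_lambda_beta bcross_nth
    by (intro tendsto_intros u LIMSEQ_subseq_LIMSEQ[OF lim])
  then have "det_cubic0 T (bcross u \<beta>) = 0" for \<beta>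
    using U(2) by (simp add: LIMSEQ_const_iff)
  then show "T \<in> {T. vanishing_line T}" using u(1) unfolding vanishing_line_iff_sphere by blast
qed

subsection \<open>The tensor network variety\<close>

text \<open>A single sum over index triples, so that composition needs only one exchange of
  sums.\<close>

lemma tensor_map_nth:
  "tensor_map X Y Z T $ (i, j, k)
    = (\<Sum>x\<in>UNIV. X $ i $ fst x * Y $ j $ fst (snd x) * Z $ k $ snd (snd x) * T $ x)"
proof -
  have "(\<Sum>x\<in>UNIV. X $ i $ fst x * Y $ j $ fst (snd x) * Z $ k $ snd (snd x) * T $ x)
    = (\<Sum>p\<in>UNIV. \<Sum>q\<in>UNIV. \<Sum>r\<in>UNIV. X $ i $ p * Y $ j $ q * Z $ k $ r * T $ (p, q, r))"
    by (simp add: sum.cartesian_product' flip: UNIV_Times_UNIV)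
  then show ?thesis by (simp add: tensor_map_def)
qed

lemma tensor_map_tensor_map:
  "tensor_map X Y Z (tensor_map X' Y' Z' T) = tensor_map (X ** X') (Y ** Y') (Z ** Z') T"
proof -
  have "tensor_map X Y Z (tensor_map X' Y' Z' T) $ (i, j, k)
      = tensor_map (X ** X') (Y ** Y') (Z ** Z') T $ (i, j, k)" for i j k
  proof -
    have prod: "(\<Sum>x\<in>UNIV. f (fst x) * g (fst (snd x)) * h (snd (snd x)))
      = (\<Sum>p\<in>UNIV. f p) * (\<Sum>q\<in>UNIV. g q) * (\<Sum>r\<in>UNIV. h r)"
      for f :: "_ \<Rightarrow> complex" and g h
      by (simp add: sum.cartesian_product' mult.assoc
          flip: UNIV_Times_UNIV sum_distrib_left sum_distrib_right)
    have "tensor_map X Y Z (tensor_map X' Y' Z' T) $ (i, j, k)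
      = (\<Sum>x\<in>UNIV. \<Sum>y\<in>UNIV. (X $ i $ fst x * X' $ fst x $ fst y)
          * (Y $ j $ fst (snd x) * Y' $ fst (snd x) $ fst (snd y))
          * (Z $ k $ snd (snd x) * Z' $ snd (snd x) $ snd (snd y)) * T $ y)"
      unfolding tensor_map_nth[of X Y Z]
      by (rule sum.cong) (auto simp: tensor_map_nth sum_distrib_left mult_ac)
    also have "\<dots> = (\<Sum>y\<in>UNIV. \<Sum>x\<in>UNIV. (X $ i $ fst x * X' $ fst x $ fst y)
          * (Y $ j $ fst (snd x) * Y' $ fst (snd x) $ fst (snd y))
          * (Z $ k $ snd (snd x) * Z' $ snd (snd x) $ snd (snd y)) * T $ y)"
      by (rule sum.swap)
    also have "\<dots> = tensor_map (X ** X') (Y ** Y') (Z ** Z') T $ (i, j, k)"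
      unfolding tensor_map_nth
      by (rule sum.cong[OF refl], subst sum_distrib_right[symmetric])
        (simp only: prod[of "\<lambda>p. X $ i $ p * X' $ p $ _" "\<lambda>q. Y $ j $ q * Y' $ q $ _" "\<lambda>r. Z $ k $ r * Z' $ r $ _"]
          matrix_matrix_mult_def vec_lambda_beta)
    finally show ?thesis .
  qed
  then show ?thesis by (simp add: vec_eq_iff split_paired_all)
qed

lemma tensor_map_mat1: "tensor_map (mat 1) (mat 1) (mat 1) T = T"
proof -
  have "tensor_map (mat 1) (mat 1) (mat 1) T $ (i, j, k) = T $ (i, j, k)" for i j k
  proof -
    have "tensor_map (mat 1) (mat 1) (mat 1) T $ (i, j, k) = (\<Sum>x\<in>UNIV. if x = (i, j, k) then T $ x else 0)"
      unfolding tensor_map_nth by (rule sum.cong) (auto simp: mat_def)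
    then show ?thesis by simp
  qed
  then show ?thesis by (simp add: vec_eq_iff split_paired_all)
qed

lemma tensor_map_sum: "tensor_map X Y Z (\<Sum>i\<in>I. f i) = (\<Sum>i\<in>I. tensor_map X Y Z (f i))"
proof -
  have "tensor_map X Y Z (\<Sum>i\<in>I. f i) $ (a, b, c) = (\<Sum>i\<in>I. tensor_map X Y Z (f i)) $ (a, b, c)" for a b c
    by (simp add: tensor_map_nth sum_distrib_left) (rule sum.swap)
  then show ?thesis by (simp add: vec_eq_iff split_paired_all)
qed

lemma tendsto_tensor_map:
  fixes X :: "complex^'p^'a" and Y :: "complex^'q^'b" and Z :: "complex^'r^'c"
  assumes "(f \<longlongrightarrow> T) F"
  shows "((\<lambda>x. tensor_map X Y Z (f x)) \<longlongrightarrow> tensor_map X Y Z T) F"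
proof (rule vec_tendstoI)
  fix i :: "'a \<times> 'b \<times> 'c"
  obtain a b c where i: "i = (a, b, c)" by (cases i)
  show "((\<lambda>x. tensor_map X Y Z (f x) $ i) \<longlongrightarrow> tensor_map X Y Z T $ i) F"
    unfolding i tensor_map_nth by (intro tendsto_intros assms)
qed

lemma tensor_map_closure:
  assumes "T \<in> closure S" "\<And>T. T \<in> S \<Longrightarrow> tensor_map X Y Z T \<in> closure S'"
  shows "tensor_map X Y Z T \<in> closure S'"
proof -
  obtain f where f: "\<And>n. f n \<in> S" "f \<longlonglongrightarrow> T" using assms(1) closure_sequential by blast
  show ?thesis
    using closed_sequentially[OF closed_closure assms(2)[OF f(1)] tendsto_tensor_map[OF f(2)]] .
qed

section \<open>The triangle tensor and its determinantal cubic\<close>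

lemma UNIV_2_eq: "(UNIV :: 2 set) = {0, 1}"
proof -
  have "(2::2) = 0" by simp
  then show ?thesis unfolding UNIV_2 by auto
qed

lemma sum_2_eq: "sum f (UNIV :: 2 set) = f 0 + f 1"
  by (simp add: UNIV_2_eq)

lemma matrix_vector_mult_axis_nth: "(X *v axis x 1) $ a = (X $ a $ x :: complex)"
proof -
  have "(X *v axis x 1) $ a = (\<Sum>j\<in>UNIV. if j = x then X $ a $ j else 0)"
    unfolding matrix_vector_mult_def axis_def vec_lambda_beta by (rule sum.cong) auto
  then show ?thesis by simp
qed

lemma tensor_map_triangle:
  "tensor_map X0 X1 X2 triangle_tensor $ (a, b, c)
    = (\<Sum>i\<in>UNIV. \<Sum>j\<in>UNIV. \<Sum>k\<in>UNIV. X0 $ a $ (i, j) * X1 $ b $ (j, k) * X2 $ c $ (k, i))"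
  unfolding triangle_tensor_def tensor_map_sum tensor_map_tensor
  by (simp add: tensor_def matrix_vector_mult_axis_nth)

lemma cyc_tensor_map_triangle:
  "cyc (tensor_map X0 X1 X2 triangle_tensor) = tensor_map X1 X2 X0 triangle_tensor"
proof -
  have "cyc (tensor_map X0 X1 X2 triangle_tensor) $ (i, j, k)
      = tensor_map X1 X2 X0 triangle_tensor $ (i, j, k)" for i j k
    by (simp add: cyc_def tensor_map_triangle sum_2_eq algebra_simps)
  then show ?thesis by (simp add: vec_eq_iff split_paired_all)
qed

text \<open>The Cauchy-Binet formula for the 3 x 4 matrix with columns \<open>s1\<close> to
  \<open>s4\<close> times the 4 x 3 matrix with rows \<open>z1\<close> to \<open>z4\<close>.\<close>

lemma cauchy_binet_3_4:
  "det (\<chi> b c. s1$b * z1$c + s2$b * z2$c + s3$b * z3$c + s4$b * z4$c)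
    = btriple s1 s2 s3 * btriple z1 z2 z3 + btriple s1 s2 s4 * btriple z1 z2 z4
    + btriple s1 s3 s4 * btriple z1 z3 z4 + btriple s2 s3 s4 * btriple z2 z3 z4"
  unfolding det_3_eq btriple_def bdot_def sum_3_eq bcross_nth vec_lambda_beta by algebra

text \<open>For the matrices \<open>A, B, C\<close> of the three factors the contraction by \<open>A\<close> is a compression of
  \<open>A \<otimes> I\<close>, and every \<open>3 \<times> 3\<close> minor of \<open>A \<otimes> I\<close> is \<open>det A\<close> times an entry of \<open>A\<close> or zero.\<close>

lemma vanishing_line_triangle: "vanishing_line (tensor_map X0 X1 X2 triangle_tensor)"
proof -
  define T where "T = tensor_map X0 X1 X2 triangle_tensor"
  define x where "x i j = (\<chi> a. X0 $ a $ (i, j))" for i j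
  define y where "y i j = (\<chi> a. X1 $ a $ (i, j))" for i j
  define z where "z i j = (\<chi> a. X2 $ a $ (i, j))" for i j
  \<comment> \<open>Once \<open>det A\<close> is split off from the Cauchy-Binet sum,
    \<open>k i j\<close> is the coefficient of \<open>A i j\<close> in the remaining linear
    form.\<close>
  define k where "k i j = btriple (y 0 0) (y 1 0) (y j 1) * btriple (z 0 0) (z 0 1) (z 1 i)
    + btriple (y j 0) (y 0 1) (y 1 1) * btriple (z 0 i) (z 1 0) (z 1 1)" for i j
  define u where "u = k 0 0 *s x 0 0 + k 0 1 *s x 0 1 + k 1 0 *s x 1 0 + k 1 1 *s x 1 1"
  have "det_cubic0 T \<alpha> = bdot u \<alpha> * (bdot (x 0 0) \<alpha> * bdot (x 1 1) \<alpha> - bdot (x 0 1) \<alpha> * bdot (x 1 0) \<alpha>)" for \<alpha>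
  proof -
    define A where "A i j = bdot (x i j) \<alpha>" for i j
    define s where "s r p = A p 0 *s y 0 r + A p 1 *s y 1 r" for r p
    have "contract0 T \<alpha> = (\<chi> b c. s 0 0 $ b * z 0 0 $ c + s 0 1 $ b * z 0 1 $ c
        + s 1 0 $ b * z 1 0 $ c + s 1 1 $ b * z 1 1 $ c)"
      by (simp add: contract0_def T_def tensor_map_triangle vec_eq_iff s_def A_def x_def y_def z_def
          bdot_def sum_2_eq sum_3_eq algebra_simps)
    then have det_eq: "det_cubic0 T \<alpha> = btriple (s 0 0) (s 0 1) (s 1 0) * btriple (z 0 0) (z 0 1) (z 1 0)
      + btriple (s 0 0) (s 0 1) (s 1 1) * btriple (z 0 0) (z 0 1) (z 1 1)
      + btriple (s 0 0) (s 1 0) (s 1 1) * btriple (z 0 0) (z 1 0) (z 1 1)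
      + btriple (s 0 1) (s 1 0) (s 1 1) * btriple (z 0 1) (z 1 0) (z 1 1)"
      by (simp add: det_cubic0_def cauchy_binet_3_4)
    have minors: "btriple (s 0 0) (s 0 1) (s 1 p)
        = (A 0 0 * A 1 1 - A 0 1 * A 1 0) * (A p 0 * btriple (y 0 0) (y 1 0) (y 0 1) + A p 1 * btriple (y 0 0) (y 1 0) (y 1 1))"
      "btriple (s 0 p) (s 1 0) (s 1 1)
        = (A 0 0 * A 1 1 - A 0 1 * A 1 0) * (A p 0 * btriple (y 0 0) (y 0 1) (y 1 1) + A p 1 * btriple (y 1 0) (y 0 1) (y 1 1))" for p
      by (simp_all add: s_def coords3) algebra+
    show ?thesis
      unfolding det_eq minors u_def k_def bdot_linear A_def[symmetric] by algebra
  qed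
  then have det: "det_cubic0 T \<alpha> = 0" if "bdot u \<alpha> = 0" for \<alpha> using that by simp
  show ?thesis
  proof (cases "u = 0")
    case True
    then have "det_cubic0 T \<alpha> = 0" for \<alpha> by (intro det) simp
    then show ?thesis unfolding vanishing_line_def T_def
      by (intro exI[of _ "axis 0 1"]) (simp add: axis_eq_0_iff)
  next
    case False
    then show ?thesis using det unfolding vanishing_line_def T_def by blast
  qed
qed

section \<open>Passing to the closure\<close>

lemma tendsto_cyc:
  assumes "(f \<longlongrightarrow> T) F"
  shows "((\<lambda>x. cyc (f x)) \<longlongrightarrow> cyc T) F"
proof (rule vec_tendstoI)
  fix i :: "3 \<times> 3 \<times> 3"
  obtain a b c where i: "i = (a, b, c)" by (cases i)
  show "((\<lambda>x. cyc (f x) $ i) \<longlongrightarrow> cyc T $ i) F"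
    by (simp add: i cyc_def) (intro tendsto_intros assms)
qed

lemma vanishing_line_TNS:
  assumes "T \<in> TNS_triangle" shows "vanishing_line T"
proof -
  have "TNS_triangle \<subseteq> {T. vanishing_line T}"
    unfolding TNS_triangle_def
    by (rule closure_minimal[OF _ closed_vanishing_line]) (auto simp: vanishing_line_triangle)
  then show ?thesis using assms by blast
qed

lemma cyc_TNS:
  assumes "T \<in> TNS_triangle" shows "cyc T \<in> TNS_triangle"
proof -
  obtain f where f: "\<And>n. f n \<in> {tensor_map X0 X1 X2 triangle_tensor | X0 X1 X2. True}" "f \<longlonglongrightarrow> T"
    using assms closure_sequential unfolding TNS_triangle_def by blast
  have "cyc (f n) \<in> {tensor_map X0 X1 X2 triangle_tensor | X0 X1 X2. True}" for n
  proof -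
    obtain X0 X1 X2 where "f n = tensor_map X0 X1 X2 triangle_tensor" using f(1)[of n] by blast
    then have "cyc (f n) = tensor_map X1 X2 X0 triangle_tensor"
      by (simp add: cyc_tensor_map_triangle)
    then show ?thesis by blast
  qed
  then show ?thesis
    unfolding TNS_triangle_def closure_sequential
    by (intro exI[of _ "\<lambda>n. cyc (f n)"] conjI allI tendsto_cyc[OF f(2)])
qed

lemma vanishing_lines_TNS:
  assumes "T \<in> TNS_triangle" shows "vanishing_line T" "vanishing_line (cyc T)" "vanishing_line (cyc (cyc T))"
  using assms cyc_TNS vanishing_line_TNS by blast+

lemma tensor_map_TNS:
  assumes "T \<in> TNS_triangle" shows "tensor_map X Y Z T \<in> TNS_triangle"
  using assms unfolding TNS_triangle_def
  by (rule tensor_map_closure) (use closure_subset in \<open>fastforce simp: tensor_map_tensor_map\<close>)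

subsection \<open>The family as tensor networks\<close>

text \<open>Stands in for polynomial functions on the tensor space; only their restrictions to lines
  enter.\<close>

definition line_poly :: "((3, 3, 3) tensor3 \<Rightarrow> complex) \<Rightarrow> bool"
  where "line_poly F \<longleftrightarrow> (\<forall>T D. \<exists>p. \<forall>\<epsilon>. F (T + \<epsilon> *s D) = poly p \<epsilon>)"

lemma line_poly_nth: "line_poly (\<lambda>T. T $ x)"
  unfolding line_poly_def
proof (intro allI)
  fix T D :: "(3, 3, 3) tensor3"
  show "\<exists>p. \<forall>\<epsilon>. (T + \<epsilon> *s D) $ x = poly p \<epsilon>"
    by (intro exI[of _ "[:T $ x, D $ x:]"]) simp
qed

lemma line_poly_const: "line_poly (\<lambda>T. c)"
  unfolding line_poly_def by (intro allI exI[of _ "[:c:]"]) simp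

lemma line_poly_add: "line_poly F \<Longrightarrow> line_poly G \<Longrightarrow> line_poly (\<lambda>T. F T + G T)"
  unfolding line_poly_def by (metis poly_add)

lemma line_poly_diff: "line_poly F \<Longrightarrow> line_poly G \<Longrightarrow> line_poly (\<lambda>T. F T - G T)"
  unfolding line_poly_def by (metis poly_diff)

lemma line_poly_mult: "line_poly F \<Longrightarrow> line_poly G \<Longrightarrow> line_poly (\<lambda>T. F T * G T)"
  unfolding line_poly_def by (metis poly_mult)

lemma line_poly_power: "line_poly F \<Longrightarrow> line_poly (\<lambda>T. F T ^ n)"
  by (induction n) (simp_all add: line_poly_const line_poly_mult)

lemmas line_poly_intros = line_poly_nth line_poly_const line_poly_add line_poly_diff
  line_poly_mult line_poly_power

text \<open>On the line through \<open>T\<close> and \<open>T'\<close> the polynomial is nonzero at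
  parameter 1, so it has finitely many roots. Points of \<open>S\<close> therefore accumulate at
  \<open>T\<close>.\<close>

lemma closed_generic_line:
  assumes "closed S" "line_poly F" "F T' \<noteq> 0"
    and S: "\<And>\<epsilon>. F (T + \<epsilon> *s (T' - T)) \<noteq> 0 \<Longrightarrow> T + \<epsilon> *s (T' - T) \<in> S"
  shows "T \<in> S"
proof -
  obtain p where p: "\<And>\<epsilon>. F (T + \<epsilon> *s (T' - T)) = poly p \<epsilon>"
    using assms(2) unfolding line_poly_def by blast
  have "poly p 1 \<noteq> 0" using assms(3) by (simp flip: p)
  then have "finite {\<epsilon>. poly p \<epsilon> = 0}" by (intro poly_roots_finite) auto
  then have "\<forall>\<^sub>F \<epsilon> in at 0. \<epsilon> \<notin> {\<epsilon>. poly p \<epsilon> = 0}"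
    using islimpt_finite islimpt_iff_eventually by blast
  then have "\<forall>\<^sub>F \<epsilon> in at 0. T + \<epsilon> *s (T' - T) \<in> S"
    by eventually_elim (use S p in auto)
  moreover have "((\<lambda>\<epsilon>. T + \<epsilon> *s (T' - T)) \<longlongrightarrow> T) (at 0)"
  proof (rule vec_tendstoI)
    fix i
    have "((\<lambda>\<epsilon>. T $ i + \<epsilon> * (T' $ i - T $ i)) \<longlongrightarrow> T $ i + 0 * (T' $ i - T $ i)) (at 0)"
      by (intro tendsto_intros)
    then show "((\<lambda>\<epsilon>. (T + \<epsilon> *s (T' - T)) $ i) \<longlongrightarrow> T $ i) (at 0)" by (simp add: right_diff_distrib)
  qed
  ultimately show ?thesis
    using Lim_in_closed_set[OF assms(1)] by (metis trivial_limit_at)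
qed

section \<open>Members of the family as networks and limits of networks\<close>

lemma distinct_2 [simp]: "(0::2) \<noteq> 1" "(1::2) \<noteq> 0"
  by simp_all

lemma T_II2_nth: "T_II2 lam $ (i, j, k) =
   (if (i, j, k) \<in> {(0, 0, 0), (1, 1, 1), (2, 2, 2), (0, 2, 1)} then 1
    else if (i, j, k) \<in> {(0, 1, 2), (1, 2, 0), (2, 0, 1)} then lam else 0)"
proof -
  have "\<forall>i j k. T_II2 lam $ (i, j, k) =
   (if (i, j, k) \<in> {(0, 0, 0), (1, 1, 1), (2, 2, 2), (0, 2, 1)} then 1
    else if (i, j, k) \<in> {(0, 1, 2), (1, 2, 0), (2, 0, 1)} then lam else 0)"
    unfolding forall_3_iff by (simp add: T_II2_def basis_tensor_def tensor_def axis_def)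
  then show ?thesis by blast
qed

lemma tensor_eq_iff:
  fixes S T :: "(3, 3, 3) tensor3"
  shows "S = T \<longleftrightarrow> (\<forall>i j k. S $ (i, j, k) = T $ (i, j, k))"
  by (simp add: vec_eq_iff)

text \<open>Since \<open>tr (A B C)\<close> has the coefficient \<open>1 + lam ^ 3\<close> at the three diagonal matrices, a rescaling
  by \<open>d\<close> is needed.\<close>

lemma T_II2_generic_TNS:
  assumes "lam ^ 3 \<noteq> -1" shows "T_II2 lam \<in> TNS_triangle"
proof -
  define d where "d = csqrt (inverse (1 + lam ^ 3))"
  have "1 + lam ^ 3 \<noteq> 0" using assms by (simp add: add_eq_0_iff)
  moreover have "d\<^sup>2 = inverse (1 + lam ^ 3)" by (simp add: d_def)
  ultimately have d: "d * d * (1 + lam ^ 3) = 1" unfolding power2_eq_square by simp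
  then have d0: "d \<noteq> 0" by auto
  define diag where "diag = (\<lambda>x. if x = (0::2, 0::2) then 1 else if x = (1, 1) then lam else 0)"
  define E where "E p q x = (if x = (p::2, q::2) then 1 else 0 :: complex)" for p q x
  \<comment> \<open>The diagonal matrix sits at the indices 0, 2, 1 of the three factors, so the
    entry at \<open>(0, 2, 1)\<close> is \<open>d * d\<close> times the trace of its cube, which is
    1.\<close>
  define X0 :: "complex^(2 \<times> 2)^3" where "X0 = (\<chi> i x. if i = 0 then d * d * diag x
    else if i = 1 then d * E 0 1 x else d * E 1 0 x)"
  define X1 :: "complex^(2 \<times> 2)^3" where "X1 = (\<chi> i x. if i = 2 then diag x
    else if i = 0 then E 0 1 x / d else E 1 0 x / d)"
  define X2 :: "complex^(2 \<times> 2)^3" where "X2 = (\<chi> i x. if i = 1 then diag x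
    else if i = 2 then E 0 1 x / d else E 1 0 x / d)"
  have "T_II2 lam = tensor_map X0 X1 X2 triangle_tensor"
    unfolding tensor_eq_iff forall_3_iff tensor_map_triangle sum_2_eq X0_def X1_def X2_def
    using d d0 by (simp add: T_II2_nth diag_def E_def algebra_simps power3_eq_cube)
  then show ?thesis
    unfolding TNS_triangle_def by (intro subsetD[OF closure_subset]) blast
qed

text \<open>Parameters with \<open>lam ^ 3 = -1\<close> are reached as limits, since the line to
  \<open>T_II2 0\<close> stays inside the family.\<close>

lemma T_II2_TNS: "T_II2 lam \<in> TNS_triangle"
proof (rule closed_generic_line[where T' = "T_II2 0" and F = "\<lambda>T. T $ (0, 1, 2) ^ 3 + 1"])
  show "closed TNS_triangle" by (simp add: TNS_triangle_def)
  show "line_poly (\<lambda>T. T $ (0, 1, 2) ^ 3 + 1)" by (intro line_poly_intros)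
  show "T_II2 0 $ (0, 1, 2) ^ 3 + 1 \<noteq> 0" by (simp add: T_II2_nth)
  fix e
  have T: "T_II2 lam + e *s (T_II2 0 - T_II2 lam) = T_II2 (lam - e * lam)"
    unfolding tensor_eq_iff forall_3_iff by (simp add: T_II2_nth)
  assume "(T_II2 lam + e *s (T_II2 0 - T_II2 lam)) $ (0, 1, 2) ^ 3 + 1 \<noteq> 0"
  then have "(lam - e * lam) ^ 3 \<noteq> -1" unfolding T by (auto simp: T_II2_nth)
  then show "T_II2 lam + e *s (T_II2 0 - T_II2 lam) \<in> TNS_triangle"
    unfolding T by (rule T_II2_generic_TNS)
qed

lemma orbit_closure_subset_TNS: "orbit_closure_II2 \<subseteq> TNS_triangle"
  unfolding orbit_closure_II2_def
proof (rule closure_minimal)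
  show "closed TNS_triangle" by (simp add: TNS_triangle_def)
qed (auto intro: tensor_map_TNS T_II2_TNS)

subsection \<open>Normal forms of tensors with a zero block\<close>

definition rows3 :: "complex^3 \<Rightarrow> complex^3 \<Rightarrow> complex^3 \<Rightarrow> complex^3^3"
  where "rows3 a b c = (\<chi> i. if i = 0 then a else if i = 1 then b else c)"

definition vec3 :: "complex \<Rightarrow> complex \<Rightarrow> complex \<Rightarrow> complex^3"
  where "vec3 a b c = (\<chi> i. if i = 0 then a else if i = 1 then b else c)"

definition supported_on :: "(3 \<times> 3 \<times> 3) set \<Rightarrow> (3, 3, 3) tensor3 \<Rightarrow> bool"
  where "supported_on I T \<longleftrightarrow> (\<forall>x. x \<notin> I \<longrightarrow> T $ x = 0)"

lemma rows3_nth [simp]: "rows3 a b c $ 0 = a" "rows3 a b c $ 1 = b" "rows3 a b c $ 2 = c"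
  by (simp_all add: rows3_def)

lemma vec3_nth [simp]: "vec3 a b c $ 0 = a" "vec3 a b c $ 1 = b" "vec3 a b c $ 2 = c"
  by (simp_all add: vec3_def)

lemma invertible_rows3: "invertible (rows3 a b c) \<longleftrightarrow> btriple a b c \<noteq> 0"
  by (simp add: invertible_det_nz det_eq_btriple)

text \<open>A base change is thus prescribed by placing the new dual basis vectors in the rows of
  the matrices.\<close>

lemma tensor_map_nth_tri: "tensor_map X Y Z T $ (i, j, k) = tri T (X $ i) (Y $ j) (Z $ k)"
  by (simp add: tensor_map_def tri_def)

lemma tri_axis: "tri T (axis i 1) (axis j 1) (axis k 1) = T $ (i, j, k)"
proof -
  have "contract0 T (axis i 1) $ j $ k = T $ (i, j, k)"
    using bdot_axis(2)[of i "\<chi> i. T $ (i, j, k)"] by (simp add: contract0_def bdot_def)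
  then show ?thesis by (simp add: tri_eq_contract0 matrix_vector_mult_axis_nth)
qed

lemma supported_on_iff:
  "supported_on I T \<longleftrightarrow> (\<forall>i j k. (i, j, k) \<notin> I \<longrightarrow> T $ (i, j, k) = 0)"
  by (simp add: supported_on_def)

lemma supported_on_line:
  "supported_on I T \<Longrightarrow> supported_on I T' \<Longrightarrow> supported_on I (T + e *s (T' - T))"
  by (simp add: supported_on_def)

lemma T_II2_orbit_closure:
  assumes "invertible g0" "invertible g1" "invertible g2"
  shows "tensor_map g0 g1 g2 (T_II2 lam) \<in> orbit_closure_II2"
  unfolding orbit_closure_II2_def using assms by (intro subsetD[OF closure_subset]) blast

text \<open>Justifies passing to normal forms: the inverse matrices preserve the orbits and, by
  continuity, their closure.\<close>

lemma orbit_closure_if_tensor_map: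
  assumes A: "invertible A" and B: "invertible B" and C: "invertible C"
    and T: "tensor_map A B C T \<in> orbit_closure_II2"
  shows "T \<in> orbit_closure_II2"
proof -
  obtain A' where A': "A' ** A = mat 1" "A ** A' = mat 1" using A by (auto simp: invertible_def)
  obtain B' where B': "B' ** B = mat 1" "B ** B' = mat 1" using B by (auto simp: invertible_def)
  obtain C' where C': "C' ** C = mat 1" "C ** C' = mat 1" using C by (auto simp: invertible_def)
  have inv: "invertible A'" "invertible B'" "invertible C'"
    using A' B' C' unfolding invertible_def by blast+
  have "tensor_map A' B' C' (tensor_map A B C T) \<in> orbit_closure_II2"
    unfolding orbit_closure_II2_def
  proof (rule tensor_map_closure[OF T[unfolded orbit_closure_II2_def]], elim CollectE exE conjE)
    fix S :: "(3, 3, 3) tensor3" and g0 g1 g2 lam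
    assume S: "S = tensor_map g0 g1 g2 (T_II2 lam)" and g: "invertible g0" "invertible g1" "invertible g2"
    show "tensor_map A' B' C' S \<in> closure {tensor_map g0 g1 g2 (T_II2 lam) | g0 g1 g2 lam.
      invertible g0 \<and> invertible g1 \<and> invertible g2}"
      unfolding S tensor_map_tensor_map
      using T_II2_orbit_closure[OF invertible_mult[OF inv(1) g(1)] invertible_mult[OF inv(2) g(2)]
          invertible_mult[OF inv(3) g(3)]]
      unfolding orbit_closure_II2_def by blast
  qed
  then show ?thesis by (simp add: tensor_map_tensor_map A' B' C' tensor_map_mat1)
qed

text \<open>The support of \<open>T_II2\<close>, where the indices of the second and the third factor are permuted
  cyclically (by \<open>j \<mapsto> j + 2\<close> and \<open>k \<mapsto> k + 1\<close>) such that the zero block becomes \<open>{1, 2}\<^sup>3\<close>.\<close>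

definition I_torus :: "(3 \<times> 3 \<times> 3) set"
  where "I_torus = {(0, 0, 0), (0, 1, 2), (0, 2, 1), (2, 0, 1), (1, 0, 2), (1, 2, 0), (2, 1, 0)}"

text \<open>The added entries, with exactly one nonzero index, are the linear part that unipotent
  substitutions remove.\<close>

definition I_unipotent :: "(3 \<times> 3 \<times> 3) set"
  where "I_unipotent = I_torus \<union> {(1, 0, 0), (2, 0, 0), (0, 1, 0), (0, 2, 0), (0, 0, 1), (0, 0, 2)}"

definition I_block :: "(3 \<times> 3 \<times> 3) set"
  where "I_block = {(i, j, k). i = 0 \<or> j = 0 \<or> k = 0}"

section \<open>Torus action on the smallest support\<close>

lemma closed_orbit_closure: "closed orbit_closure_II2"
  by (simp add: orbit_closure_II2_def)

lemma ex_cube_root: "\<exists>z::complex. z ^ 3 = c"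
proof (cases "c = 0")
  case False
  have "exp (Ln c / 3) ^ 3 = exp (of_nat 3 * (Ln c / 3))" by (rule exp_of_nat_mult[symmetric])
  then show ?thesis using False by auto
qed auto

text \<open>The quotient of \<open>m2 * n2 * p2\<close> by \<open>m1 * n1 * p1\<close> is invariant
  under diagonal scaling and equals \<open>lam ^ 3\<close> on the permuted family; this dictates
  \<open>lam\<close>.\<close>

lemma torus_generic:
  assumes supp: "supported_on I_torus T" and nz: "\<forall>x\<in>I_torus. T $ x \<noteq> 0"
  shows "T \<in> orbit_closure_II2"
proof -
  define t where "t = T $ (0, 0, 0)"
  define m1 where "m1 = T $ (0, 1, 2)"
  define m2 where "m2 = T $ (0, 2, 1)"
  define n1 where "n1 = T $ (2, 0, 1)"
  define n2 where "n2 = T $ (1, 0, 2)"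
  define p1 where "p1 = T $ (1, 2, 0)"
  define p2 where "p2 = T $ (2, 1, 0)"
  note defs = t_def m1_def m2_def n1_def n2_def p1_def p2_def
  have nz: "t \<noteq> 0" "m1 \<noteq> 0" "m2 \<noteq> 0" "n1 \<noteq> 0" "n2 \<noteq> 0" "p1 \<noteq> 0" "p2 \<noteq> 0"
    using nz by (simp_all add: defs I_torus_def)
  obtain lam where lam: "lam ^ 3 = (n2 * m2 * p2) / (p1 * n1 * m1)" using ex_cube_root by blast
  then have lam0: "lam \<noteq> 0" using nz by auto
  have lam': "lam * lam * lam * (p1 * n1 * m1) = n2 * m2 * p2"
    using lam nz by (simp add: power3_eq_cube)
  \<comment> \<open>The scalings match \<open>t\<close>, \<open>n1\<close>, \<open>n2\<close>,
    \<open>p1\<close>, \<open>p2\<close> for any nonzero \<open>a\<close>; this \<open>a\<close>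
    fits \<open>m2\<close>, and \<open>m1\<close> then follows from the choice of
    \<open>lam\<close>. The rows also undo the cyclic index shifts.\<close>
  define a where "a = p1 * n1 * t * lam / m2"
  have a0: "a \<noteq> 0" using nz lam0 by (simp add: a_def)
  define g0 where "g0 = rows3 (t *s axis 0 1) (a *s axis 1 1) (1 *s axis 2 1)"
  define g1 where "g1 = rows3 (1 *s axis 2 1) ((p2 / lam) *s axis 0 1) ((p1 / a) *s axis 1 1)"
  define g2 where "g2 = rows3 (1 *s axis 1 1) (n1 *s axis 2 1) ((n2 / (lam * a)) *s axis 0 1)"
  have "T = tensor_map g0 g1 g2 (T_II2 lam)"
  proof -
    have "m1 = t * (p2 / lam) * (n2 / (lam * a))" "m2 = t * (p1 / a) * n1 * lam"
      using nz lam0 lam' by (simp_all add: a_def field_simps)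
    then show ?thesis
      using supp nz lam0 a0 unfolding tensor_eq_iff supported_on_iff forall_3_iff tensor_map_nth_tri
      by (simp add: g0_def g1_def g2_def tri_linear tri_axis T_II2_nth I_torus_def mult_ac flip: defs)
  qed
  moreover have "invertible g0" "invertible g1" "invertible g2"
    using nz lam0 a0 by (simp_all add: g0_def g1_def g2_def invertible_rows3 coords3 axis_def)
  ultimately show ?thesis using T_II2_orbit_closure by blast
qed

lemma torus_orbit_closure:
  assumes supp: "supported_on I_torus T"
  shows "T \<in> orbit_closure_II2"
proof (rule closed_generic_line[OF closed_orbit_closure])
  let ?F = "\<lambda>T :: (3, 3, 3) tensor3. T $ (0, 0, 0) * T $ (0, 1, 2) * T $ (0, 2, 1) * T $ (2, 0, 1)
    * T $ (1, 0, 2) * T $ (1, 2, 0) * T $ (2, 1, 0)"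
  let ?T' = "(\<chi> x. if x \<in> I_torus then 1 else 0) :: (3, 3, 3) tensor3"
  show "line_poly ?F" by (intro line_poly_intros)
  show "?F ?T' \<noteq> 0" by (simp add: I_torus_def)
  fix e assume "?F (T + e *s (?T' - T)) \<noteq> 0"
  then have "\<forall>x\<in>I_torus. (T + e *s (?T' - T)) $ x \<noteq> 0" unfolding I_torus_def by simp
  moreover have "supported_on I_torus (T + e *s (?T' - T))"
    by (rule supported_on_line[OF supp]) (simp add: supported_on_def)
  ultimately show "T + e *s (?T' - T) \<in> orbit_closure_II2" using torus_generic by blast
qed

text \<open>Cramer's rule; the assumption says that the determinant of the system is
  nonzero.\<close>

lemma ex_solution_off_diagonal_system:
  fixes p n p' m n' m' x y z :: complex
  assumes "p * m * n' + n * p' * m' \<noteq> 0"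
  shows "\<exists>s t u. p * t + n * u = x \<and> p' * s + m * u = y \<and> n' * s + m' * t = z"
proof (intro exI conjI)
  let ?k = "p * m * n' + n * p' * m'"
  let ?s = "(p * m * z + n * y * m' - x * m * m') / ?k"
  let ?t = "(x * m * n' + n * p' * z - n * y * n') / ?k"
  let ?u = "(p * y * n' + x * p' * m' - p * p' * z) / ?k"
  show "p * ?t + n * ?u = x" "p' * ?s + m * ?u = y" "n' * ?s + m' * ?t = z"
    using assms by (simp_all add: divide_simps) algebra+
qed

text \<open>Multiples of rows 1 and 2 are added to row 0 in each factor. By the zero block, the
  conditions for the six linear entries to vanish are linear; they decouple into two 3 x 3 systems
  with the same determinant.\<close>

lemma unipotent_generic:
  assumes supp: "supported_on I_unipotent T"
    and k: "T $ (1, 2, 0) * T $ (0, 1, 2) * T $ (2, 0, 1) + T $ (1, 0, 2) * T $ (2, 1, 0) * T $ (0, 2, 1) \<noteq> 0"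
  shows "T \<in> orbit_closure_II2"
proof -
  obtain s2 t2 u2 where 1:
    "T $ (1, 2, 0) * t2 + T $ (1, 0, 2) * u2 = - T $ (1, 0, 0)"
    "T $ (2, 1, 0) * s2 + T $ (0, 1, 2) * u2 = - T $ (0, 1, 0)"
    "T $ (2, 0, 1) * s2 + T $ (0, 2, 1) * t2 = - T $ (0, 0, 1)"
    using ex_solution_off_diagonal_system[OF k] by blast
  have "T $ (2, 1, 0) * T $ (0, 2, 1) * T $ (1, 0, 2) + T $ (2, 0, 1) * T $ (1, 2, 0) * T $ (0, 1, 2) \<noteq> 0"
    using k by (simp add: mult_ac add.commute)
  from ex_solution_off_diagonal_system[OF this]
  obtain s1 t1 u1 where 2:
    "T $ (2, 1, 0) * t1 + T $ (2, 0, 1) * u1 = - T $ (2, 0, 0)"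
    "T $ (1, 2, 0) * s1 + T $ (0, 2, 1) * u1 = - T $ (0, 2, 0)"
    "T $ (1, 0, 2) * s1 + T $ (0, 1, 2) * t1 = - T $ (0, 0, 2)"
    by blast
  define A where "A s s' = rows3 (vec3 1 s s') (vec3 0 1 0) (vec3 0 0 1)" for s s'
  have inv: "invertible (A s s')" for s s'
    by (simp add: A_def invertible_rows3 coords3)
  have "supported_on I_torus (tensor_map (A s1 s2) (A t1 t2) (A u1 u2) T)"
    using supp 1 2
    unfolding supported_on_iff forall_3_iff tensor_map_nth_tri I_unipotent_def I_torus_def
    by (simp add: A_def tri_def sum_3_eq) algebra
  from orbit_closure_if_tensor_map[OF inv inv inv torus_orbit_closure[OF this]] show ?thesis .
qed

lemma unipotent_orbit_closure:
  assumes supp: "supported_on I_unipotent T"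
  shows "T \<in> orbit_closure_II2"
proof (rule closed_generic_line[OF closed_orbit_closure])
  let ?F = "\<lambda>T :: (3, 3, 3) tensor3. T $ (1, 2, 0) * T $ (0, 1, 2) * T $ (2, 0, 1)
    + T $ (1, 0, 2) * T $ (2, 1, 0) * T $ (0, 2, 1)"
  let ?T' = "(\<chi> x. if x \<in> I_torus then 1 else 0) :: (3, 3, 3) tensor3"
  show "line_poly ?F" by (intro line_poly_intros)
  show "?F ?T' \<noteq> 0" by (simp add: I_torus_def)
  fix e assume F: "?F (T + e *s (?T' - T)) \<noteq> 0"
  have "supported_on I_unipotent (T + e *s (?T' - T))"
    by (rule supported_on_line[OF supp]) (simp add: supported_on_def I_unipotent_def)
  then show "T + e *s (?T' - T) \<in> orbit_closure_II2" using F by (rule unipotent_generic)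
qed

text \<open>With \<open>\<beta>\<close> and \<open>\<gamma>\<close> orthogonal to a vector \<open>\<alpha>\<close> with respect to the slices \<open>k = 0\<close> and \<open>j = 0\<close>, the
  slice \<open>i = 0\<close> at \<open>(\<beta>, \<gamma>)\<close> is the binary quadratic form with coefficients \<open>q0, q1, q2\<close> in \<open>\<alpha>\<close>.  Its two roots
  are the new basis vectors.\<close>

lemma block_generic:
  assumes supp: "supported_on I_block T"
    and q0: "q0 = T $ (0, 1, 1) * T $ (1, 2, 0) * T $ (1, 0, 2) - T $ (0, 1, 2) * T $ (1, 2, 0) * T $ (1, 0, 1)
      - T $ (0, 2, 1) * T $ (1, 1, 0) * T $ (1, 0, 2) + T $ (0, 2, 2) * T $ (1, 1, 0) * T $ (1, 0, 1)"
    and q1: "q1 = T $ (0, 1, 1) * (T $ (1, 2, 0) * T $ (2, 0, 2) + T $ (2, 2, 0) * T $ (1, 0, 2))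
      - T $ (0, 1, 2) * (T $ (1, 2, 0) * T $ (2, 0, 1) + T $ (2, 2, 0) * T $ (1, 0, 1))
      - T $ (0, 2, 1) * (T $ (1, 1, 0) * T $ (2, 0, 2) + T $ (2, 1, 0) * T $ (1, 0, 2))
      + T $ (0, 2, 2) * (T $ (1, 1, 0) * T $ (2, 0, 1) + T $ (2, 1, 0) * T $ (1, 0, 1))"
    and q2: "q2 = T $ (0, 1, 1) * T $ (2, 2, 0) * T $ (2, 0, 2) - T $ (0, 1, 2) * T $ (2, 2, 0) * T $ (2, 0, 1)
      - T $ (0, 2, 1) * T $ (2, 1, 0) * T $ (2, 0, 2) + T $ (0, 2, 2) * T $ (2, 1, 0) * T $ (2, 0, 1)"
    and nz: "q0 \<noteq> 0" "q1\<^sup>2 - 4 * q0 * q2 \<noteq> 0"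
      "T $ (1, 1, 0) * T $ (2, 2, 0) - T $ (1, 2, 0) * T $ (2, 1, 0) \<noteq> 0"
      "T $ (1, 0, 1) * T $ (2, 0, 2) - T $ (1, 0, 2) * T $ (2, 0, 1) \<noteq> 0"
  shows "T \<in> orbit_closure_II2"
proof -
  define d where "d = csqrt (q1\<^sup>2 - 4 * q0 * q2)"
  have d: "d * d = q1 * q1 - 4 * q0 * q2"
    unfolding d_def by (metis power2_csqrt power2_eq_square)
  have d0: "d \<noteq> 0" using nz(2) by (simp add: d_def)
  \<comment> \<open>The sign \<open>e\<close>, 1 or -1, selects the root.\<close>
  define r where "r e = (- q1 + e * d) / (2 * q0)" for e
  have root: "q0 * (r e * r e) + q1 * r e + q2 = 0" if "e * e = 1" for e
  proof -
    have "2 * q0 * r e + q1 = e * d" using nz(1) by (simp add: r_def)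
    then have "4 * q0 * (q0 * (r e * r e) + q1 * r e + q2) = 0" using d that by algebra
    then show ?thesis using nz(1) by simp
  qed
  have r_diff: "r 1 - r (-1) \<noteq> 0"
  proof
    assume "r 1 - r (-1) = 0"
    then have "d + d = 0" using nz(1) by (simp add: r_def field_simps)
    then show False using d0 by simp
  qed
  define \<alpha> where "\<alpha> e = vec3 0 (r e) 1" for e
  define \<beta> where "\<beta> e = vec3 0 (r e * T $ (1, 2, 0) + T $ (2, 2, 0)) (- (r e * T $ (1, 1, 0) + T $ (2, 1, 0)))" for e
  define \<gamma> where "\<gamma> e = vec3 0 (r e * T $ (1, 0, 2) + T $ (2, 0, 2)) (- (r e * T $ (1, 0, 1) + T $ (2, 0, 1)))" for e
  define M where "M f = rows3 (vec3 1 0 0) (f 1) (f (-1))" for f :: "complex \<Rightarrow> complex^3"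
  have inv: "invertible (M \<alpha>)" "invertible (M \<beta>)" "invertible (M \<gamma>)"
  proof -
    have "btriple (vec3 1 0 0) (\<alpha> 1) (\<alpha> (-1)) = r 1 - r (-1)"
      by (simp add: \<alpha>_def coords3)
    then show "invertible (M \<alpha>)" using r_diff by (simp add: M_def invertible_rows3)
    \<comment> \<open>\<beta> arises from \<alpha> by a linear map whose determinant is the minor in
      \<open>nz(3)\<close>; \<gamma> is treated alike with \<open>nz(4)\<close>.\<close>
    have "btriple (vec3 1 0 0) (\<beta> 1) (\<beta> (-1)) =
      (r 1 - r (-1)) * (T $ (1, 1, 0) * T $ (2, 2, 0) - T $ (1, 2, 0) * T $ (2, 1, 0))"
      by (simp add: \<beta>_def coords3) algebra
    then show "invertible (M \<beta>)" using r_diff nz(3) by (simp add: M_def invertible_rows3)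
    have "btriple (vec3 1 0 0) (\<gamma> 1) (\<gamma> (-1)) =
      (r 1 - r (-1)) * (T $ (1, 0, 1) * T $ (2, 0, 2) - T $ (1, 0, 2) * T $ (2, 0, 1))"
      by (simp add: \<gamma>_def coords3) algebra
    then show "invertible (M \<gamma>)" using r_diff nz(4) by (simp add: M_def invertible_rows3)
  qed
  have T0: "T $ (i, j, k) = 0" if "i \<noteq> 0" "j \<noteq> 0" "k \<noteq> 0" for i j k
    using supp that by (simp add: supported_on_def I_block_def)
  have block: "tri T (\<alpha> e) (\<beta> e') (\<gamma> e'') = 0" for e e' e''
    by (simp add: tri_def sum_3_eq \<alpha>_def \<beta>_def \<gamma>_def T0)
  have iso: "tri T (\<alpha> e) (\<beta> e) (vec3 1 0 0) = 0" "tri T (\<alpha> e) (vec3 1 0 0) (\<gamma> e) = 0" for e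
    by (simp_all add: tri_def sum_3_eq \<alpha>_def \<beta>_def \<gamma>_def algebra_simps)
  have iso': "tri T (vec3 1 0 0) (\<beta> e) (\<gamma> e) = 0" if "e * e = 1" for e
  proof -
    have "tri T (vec3 1 0 0) (\<beta> e) (\<gamma> e) = q0 * (r e * r e) + q1 * r e + q2"
      unfolding q0 q1 q2 by (simp add: tri_def sum_3_eq \<beta>_def \<gamma>_def) algebra
    then show ?thesis using root[OF that] by simp
  qed
  \<comment> \<open>\<open>iso\<close> and \<open>iso'\<close> clear the diagonals of the three 2 x
    2 blocks, which leaves them antidiagonal.\<close>
  have "supported_on I_unipotent (tensor_map (M \<alpha>) (M \<beta>) (M \<gamma>) T)"
    unfolding supported_on_iff forall_3_iff tensor_map_nth_tri I_unipotent_def I_torus_def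
    by (simp add: M_def block iso iso')
  from orbit_closure_if_tensor_map[OF inv unipotent_orbit_closure[OF this]] show ?thesis .
qed

lemma block_orbit_closure:
  assumes supp: "supported_on I_block T"
  shows "T \<in> orbit_closure_II2"
proof (rule closed_generic_line[OF closed_orbit_closure])
  let ?q0 = "\<lambda>T :: (3, 3, 3) tensor3. T $ (0, 1, 1) * T $ (1, 2, 0) * T $ (1, 0, 2) - T $ (0, 1, 2) * T $ (1, 2, 0) * T $ (1, 0, 1)
      - T $ (0, 2, 1) * T $ (1, 1, 0) * T $ (1, 0, 2) + T $ (0, 2, 2) * T $ (1, 1, 0) * T $ (1, 0, 1)"
  let ?q1 = "\<lambda>T :: (3, 3, 3) tensor3. T $ (0, 1, 1) * (T $ (1, 2, 0) * T $ (2, 0, 2) + T $ (2, 2, 0) * T $ (1, 0, 2))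
      - T $ (0, 1, 2) * (T $ (1, 2, 0) * T $ (2, 0, 1) + T $ (2, 2, 0) * T $ (1, 0, 1))
      - T $ (0, 2, 1) * (T $ (1, 1, 0) * T $ (2, 0, 2) + T $ (2, 1, 0) * T $ (1, 0, 2))
      + T $ (0, 2, 2) * (T $ (1, 1, 0) * T $ (2, 0, 1) + T $ (2, 1, 0) * T $ (1, 0, 1))"
  let ?q2 = "\<lambda>T :: (3, 3, 3) tensor3. T $ (0, 1, 1) * T $ (2, 2, 0) * T $ (2, 0, 2) - T $ (0, 1, 2) * T $ (2, 2, 0) * T $ (2, 0, 1)
      - T $ (0, 2, 1) * T $ (2, 1, 0) * T $ (2, 0, 2) + T $ (0, 2, 2) * T $ (2, 1, 0) * T $ (2, 0, 1)"
  let ?F = "\<lambda>T :: (3, 3, 3) tensor3. ?q0 T * ((?q1 T)\<^sup>2 - 4 * ?q0 T * ?q2 T)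
    * (T $ (1, 1, 0) * T $ (2, 2, 0) - T $ (1, 2, 0) * T $ (2, 1, 0))
    * (T $ (1, 0, 1) * T $ (2, 0, 2) - T $ (1, 0, 2) * T $ (2, 0, 1))"
  \<comment> \<open>All three 2 x 2 blocks are identity matrices here, so
    \<open>q0 = q2 = 1\<close>, \<open>q1 = 0\<close>, and the discriminant is -4.\<close>
  let ?T' = "(\<chi> x. if x \<in> {(0, 1, 1), (0, 2, 2), (1, 0, 1), (2, 0, 2), (1, 1, 0), (2, 2, 0)} then 1 else 0) :: (3, 3, 3) tensor3"
  show "line_poly ?F" by (intro line_poly_intros)
  show "?F ?T' \<noteq> 0" by simp
  fix e assume F: "?F (T + e *s (?T' - T)) \<noteq> 0"
  have "supported_on I_block (T + e *s (?T' - T))"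
    by (rule supported_on_line[OF supp]) (simp add: supported_on_def I_block_def)
  from this refl refl refl show "T + e *s (?T' - T) \<in> orbit_closure_II2"
    by (rule block_generic) (use F in \<open>simp_all only: mult_eq_0_iff de_Morgan_disj simp_thms\<close>)
qed

lemma adapted_basis:
  assumes "x \<noteq> 0"
  obtains A :: "complex^3^3" where "invertible A" "bdot x (A $ 1) = 0" "bdot x (A $ 2) = 0"
proof -
  obtain b where b: "b \<noteq> 0" "bdot x b = 0" using ex_nonzero_orthogonal by blast
  obtain c where c: "bdot x c = 0" "bcross b c \<noteq> 0"
    using ex_bcross_neq_0_orthogonal[OF b assms] by blast
  obtain a where "btriple b c a \<noteq> 0" using ex_btriple_neq_0[OF c(2)] by blast
  then have "invertible (rows3 a b c)" by (metis invertible_rows3 btriple_rotate(1))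
  then show thesis using b(2) c(1) by (intro that[of "rows3 a b c"]) simp_all
qed

lemma zero_block_orbit_closure:
  assumes "zero_block T" shows "T \<in> orbit_closure_II2"
proof -
  obtain u v w where uvw: "u \<noteq> 0" "v \<noteq> 0" "w \<noteq> 0"
    and 0: "\<And>\<alpha> \<beta> \<gamma>. bdot u \<alpha> = 0 \<Longrightarrow> bdot v \<beta> = 0 \<Longrightarrow> bdot w \<gamma> = 0 \<Longrightarrow> tri T \<alpha> \<beta> \<gamma> = 0"
    using assms unfolding zero_block_def by blast
  obtain A :: "complex^3^3" where A: "invertible A" "bdot u (A $ 1) = 0" "bdot u (A $ 2) = 0"
    using uvw(1) by (rule adapted_basis)
  obtain B :: "complex^3^3" where B: "invertible B" "bdot v (B $ 1) = 0" "bdot v (B $ 2) = 0"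
    using uvw(2) by (rule adapted_basis)
  obtain C :: "complex^3^3" where C: "invertible C" "bdot w (C $ 1) = 0" "bdot w (C $ 2) = 0"
    using uvw(3) by (rule adapted_basis)
  have "supported_on I_block (tensor_map A B C T)"
    unfolding supported_on_iff forall_3_iff tensor_map_nth_tri I_block_def
    using 0 A(2,3) B(2,3) C(2,3) by simp
  from orbit_closure_if_tensor_map[OF A(1) B(1) C(1) block_orbit_closure[OF this]] show ?thesis .
qed

theorem theorem5p4:
  fixes T :: "(3, 3, 3) tensor3"
  shows "(T \<in> TNS_triangle \<longleftrightarrow>
           reducible_cubic (det_cubic0 T) \<and> reducible_cubic (det_cubic1 T) \<and>
           reducible_cubic (det_cubic2 T))
       \<and> (T \<in> TNS_triangle \<longleftrightarrow> T \<in> orbit_closure_II2)"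
  unfolding det_cubic1_eq_cyc det_cubic2_eq_cyc reducible_iff_vanishing_line
  \<comment> \<open>A cycle of implications: network variety, three vanishing lines, zero block,
    orbit closure, network variety.\<close>
  using vanishing_lines_TNS zero_block_if_vanishing_lines zero_block_orbit_closure orbit_closure_subset_TNS
  by blast

end
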